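(* Let $f\in H$. Then, for $x\in N$ and every $\lambda\in\rho(A)$ with $\operatorname{Re}(\lambda)\ge a_1$, $$[R(\lambda,A)f](x)=\int_N K(x,x',\lambda)\,f(x')\,dx'.$$
   Context: Let $n\ge 2$, $c_1,\dots,c_n>0$ and $0\le a_1\le a_2\le\dots\le a_n<+\infty$. Let $N_1,\dots,N_n$ be $n$ disjoint copies of $(0,+\infty)$ and let $N=\bigcup_{k=1}^n\overline{N_k}$ with the endpoints $0$ of all branches identified (star-shaped network). A function $f$ on $N$ is identified with the tuple $(f_1,\dots,f_n)$ of its restrictions to the branches, and $\int_N f\,dx:=\sum_{k=1}^n\int_0^\infty f_k\,dx$. Transmission conditions for $(u_k)_{k=1}^n$: $(T_0)$: $u_k\in C^0([0,\infty))$ and $u_i(0)=u_k(0)$ for all $i,k$; $(T_1)$: $u_k\in C^1([0,\infty))$ and $\sum_{k=1}^n c_k u_k'(0^+)=0$. $H=\prod_{k=1}^n L^2(N_k)$ (complex-valued functions) with $(u,v)_H=\sum_k(u_k,v_k)_{L^2(N_k)}$. The operator $A:D(A)\to H$ is $A(u_k)_k=(-c_k u_k''+a_k u_k)_k$ with $D(A)=\{(u_k)\in\prod_k H^2(N_k): (T_0)\text{ and }(T_1)\text{ hold}\}$ (it is self-adjoint). $R(\lambda,A)=(\lambda I-A)^{-1}$. The complex square root is $\sqrt{re^{i\phi}}=\sqrt r\,e^{i\phi/2}$ for $r>0$, $\phi\in[-\pi,\pi)$. For $\lambda\in\mathbb C$: $\xi_k(\lambda)=\sqrt{(\lambda-a_k)/c_k}$,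 $s_k(\lambda)=-\dfrac{\sum_{l\ne k}c_l\xi_l(\lambda)}{c_k\xi_k(\lambda)}$. The functions $F_\lambda^{\pm,j}:N\to\mathbb C$ are given on $\overline{N_k}$ by $F_{\lambda,k}^{\pm,j}$, where $F_{\lambda,j}^{\pm,j}(x)=\cos(\xi_j(\lambda)x)\pm i\,s_j(\lambda)\sin(\xi_j(\lambda)x)$ and $F_{\lambda,k}^{\pm,j}(x)=\exp(\pm i\xi_k(\lambda)x)$ for $k\ne j$. Let $w(\lambda)=\pm i\sum_{j=1}^n c_j\xi_j(\lambda)$. For $w(\lambda)\ne0$, $j\in\{1,\dots,n\}$ and $x\in\overline{N_j}$ define $$K(x,x',\lambda)=\begin{cases}\frac1{w(\lambda)}F_{\lambda,j}^{\pm,j}(x)\,F_{\lambda,j}^{\pm,j+1}(x'),& x'\in\overline{N_j},\ x'>x,\\ \frac1{w(\lambda)}F_{\lambda,j}^{\pm,j+1}(x)\,F_{\lambda}^{\pm,j}(x'),& x'\in\overline{N_k},\,k\ne j,\ \text{or } x'\in\overline{N_j},\ x'<x.\end{cases}$$ In all these formulas (including $w$) the sign $+$ is chosen if $\operatorname{Im}\lambda>0$ and $-$ if $\operatorname{Im}\lambda\le0$. The index $j+1$ is understood modulo $n$ ($j+1=1$ if $j=n$). *)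

theory Defs
  imports "HOL-Analysis.Analysis"
begin

text \<open>
  The branches are numbered by \<open>k \<in> {1..n}\<close>.  A function on the network is the tuple
  \<open>u :: nat \<Rightarrow> real \<Rightarrow> complex\<close> of its restrictions; only the values \<open>u k x\<close> with
  \<open>k \<in> {1..n}\<close> and \<open>x \<ge> 0\<close> matter.  A point of the network is a pair \<open>(j, x)\<close> with
  \<open>j \<in> {1..n}\<close> and \<open>x \<ge> 0\<close>, all pairs \<open>(j, 0)\<close> being names of the common vertex.

  Elements of \<open>L\<^sup>2\<close> spaces are handled through representatives, equality being equality
  almost everywhere.
\<close>

abbreviation half_line :: "real measure" where
  "half_line \<equiv> lebesgue_on {0<..}"

definition L2 :: "(real \<Rightarrow> complex) set" where
  "L2 = {g. g \<in> borel_measurable half_line \<and> integrable half_line (\<lambda>x. (cmod (g x))\<^sup>2)}"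

definition H_space :: "nat \<Rightarrow> (nat \<Rightarrow> real \<Rightarrow> complex) set" where
  "H_space n = {f. \<forall>k\<in>{1..n}. f k \<in> L2}"

definition H_eq :: "nat \<Rightarrow> (nat \<Rightarrow> real \<Rightarrow> complex) \<Rightarrow> (nat \<Rightarrow> real \<Rightarrow> complex) \<Rightarrow> bool" where
  "H_eq n f g \<longleftrightarrow> (\<forall>k\<in>{1..n}. AE x in half_line. f k x = g k x)"

definition H_norm :: "nat \<Rightarrow> (nat \<Rightarrow> real \<Rightarrow> complex) \<Rightarrow> real" where
  "H_norm n f = sqrt (\<Sum>k=1..n. \<integral>x. (cmod (f k x))\<^sup>2 \<partial>half_line)"


text \<open>
  Sobolev spaces on \<open>(0, \<infinity>)\<close> by weak derivatives, with test functions of class \<open>C\<^sup>1\<close> and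
  compact support in \<open>(0, \<infinity>)\<close>, as in Brezis, Functional Analysis, Sobolev Spaces and
  Partial Differential Equations, Chapter 8.
\<close>

definition test_function :: "(real \<Rightarrow> real) \<Rightarrow> bool" where
  "test_function \<phi> \<longleftrightarrow> \<phi> C1_differentiable_on UNIV \<and>
     compact (closure {x. \<phi> x \<noteq> 0}) \<and> closure {x. \<phi> x \<noteq> 0} \<subseteq> {0<..}"

definition is_weak_deriv :: "(real \<Rightarrow> complex) \<Rightarrow> (real \<Rightarrow> complex) \<Rightarrow> bool" where
  "is_weak_deriv u g \<longleftrightarrow> (\<forall>\<phi>. test_function \<phi> \<longrightarrow>
     (\<integral>x. deriv \<phi> x *\<^sub>R u x \<partial>half_line) = - (\<integral>x. \<phi> x *\<^sub>R g x \<partial>half_line))"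

definition H1 :: "(real \<Rightarrow> complex) set" where
  "H1 = {u \<in> L2. \<exists>g\<in>L2. is_weak_deriv u g}"

text \<open>The weak derivative is unique up to null sets; an arbitrary representative is chosen.\<close>

definition weak_deriv :: "(real \<Rightarrow> complex) \<Rightarrow> real \<Rightarrow> complex" where
  "weak_deriv u = (SOME g. g \<in> L2 \<and> is_weak_deriv u g)"

definition H2 :: "(real \<Rightarrow> complex) set" where
  "H2 = {u \<in> H1. weak_deriv u \<in> H1}"


definition C1_closed_half_line :: "(real \<Rightarrow> complex) \<Rightarrow> bool" where
  "C1_closed_half_line u \<longleftrightarrow> (\<exists>u'. continuous_on {0..} u' \<and>
     (\<forall>x\<ge>0. (u has_vector_derivative u' x) (at x within {0..})))"

definition T0 :: "nat \<Rightarrow> (nat \<Rightarrow> real \<Rightarrow> complex) \<Rightarrow> bool" where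
  "T0 n u \<longleftrightarrow> (\<forall>k\<in>{1..n}. continuous_on {0..} (u k)) \<and>
     (\<forall>i\<in>{1..n}. \<forall>k\<in>{1..n}. u i 0 = u k 0)"

definition T1 :: "nat \<Rightarrow> (nat \<Rightarrow> real) \<Rightarrow> (nat \<Rightarrow> real \<Rightarrow> complex) \<Rightarrow> bool" where
  "T1 n c u \<longleftrightarrow> (\<forall>k\<in>{1..n}. C1_closed_half_line (u k)) \<and>
     (\<Sum>k=1..n. c k *\<^sub>R vector_derivative (u k) (at 0 within {0..})) = 0"

text \<open>
  The domain consists of the continuous representatives: an element of \<open>\<Prod> H\<^sup>2(N\<^sub>k)\<close> has
  exactly one representative that is continuous on the closed branches, and the transmission
  conditions refer to that one.
\<close>

definition dom_A :: "nat \<Rightarrow> (nat \<Rightarrow> real) \<Rightarrow> (nat \<Rightarrow> real \<Rightarrow> complex) set" where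
  "dom_A n c = {u. (\<forall>k\<in>{1..n}. u k \<in> H2) \<and> T0 n u \<and> T1 n c u}"

definition op_A ::
  "(nat \<Rightarrow> real) \<Rightarrow> (nat \<Rightarrow> real) \<Rightarrow> (nat \<Rightarrow> real \<Rightarrow> complex) \<Rightarrow> nat \<Rightarrow> real \<Rightarrow> complex" where
  "op_A c a u = (\<lambda>k x. - c k *\<^sub>R weak_deriv (weak_deriv (u k)) x + a k *\<^sub>R u k x)"

definition shifted_A ::
  "(nat \<Rightarrow> real) \<Rightarrow> (nat \<Rightarrow> real) \<Rightarrow> complex \<Rightarrow> (nat \<Rightarrow> real \<Rightarrow> complex) \<Rightarrow> nat \<Rightarrow> real \<Rightarrow> complex" where
  "shifted_A c a z u = (\<lambda>k x. z * u k x - op_A c a u k x)"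

text \<open>
  \<open>\<rho>(A)\<close>: \<open>z I - A\<close> is surjective and injective from the domain to \<open>H\<close>, with bounded inverse.
\<close>

definition resolvent_set :: "nat \<Rightarrow> (nat \<Rightarrow> real) \<Rightarrow> (nat \<Rightarrow> real) \<Rightarrow> complex set" where
  "resolvent_set n c a = {z.
     (\<forall>f\<in>H_space n. \<exists>u\<in>dom_A n c. H_eq n (shifted_A c a z u) f) \<and>
     (\<forall>u\<in>dom_A n c. \<forall>v\<in>dom_A n c.
        H_eq n (shifted_A c a z u) (shifted_A c a z v) \<longrightarrow> H_eq n u v) \<and>
     (\<exists>C. \<forall>u\<in>dom_A n c. H_norm n u \<le> C * H_norm n (shifted_A c a z u))}"

text \<open>
  For \<open>z\<close> in the resolvent set the choice is unique up to values outside the network, because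
  two functions in the domain that agree almost everywhere agree at every \<open>x \<ge> 0\<close>.
\<close>

definition resolvent ::
  "nat \<Rightarrow> (nat \<Rightarrow> real) \<Rightarrow> (nat \<Rightarrow> real) \<Rightarrow> complex \<Rightarrow> (nat \<Rightarrow> real \<Rightarrow> complex) \<Rightarrow> nat \<Rightarrow> real \<Rightarrow> complex" where
  "resolvent n c a z f = (SOME u. u \<in> dom_A n c \<and> H_eq n (shifted_A c a z u) f)"


text \<open>
  The square root whose argument is taken in \<open>[-\<pi>, \<pi>)\<close>; it differs from \<^const>\<open>csqrt\<close>
  on the negative real axis.
\<close>

definition lower_arg :: "complex \<Rightarrow> real" where
  "lower_arg z = (if Arg z = pi then - pi else Arg z)"

definition lower_sqrt :: "complex \<Rightarrow> complex" where
  "lower_sqrt z = complex_of_real (sqrt (cmod z)) * exp (\<i> * complex_of_real (lower_arg z / 2))"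

definition xi :: "(nat \<Rightarrow> real) \<Rightarrow> (nat \<Rightarrow> real) \<Rightarrow> complex \<Rightarrow> nat \<Rightarrow> complex" where
  "xi c a z k = lower_sqrt ((z - complex_of_real (a k)) / complex_of_real (c k))"

definition s_coeff :: "nat \<Rightarrow> (nat \<Rightarrow> real) \<Rightarrow> (nat \<Rightarrow> real) \<Rightarrow> complex \<Rightarrow> nat \<Rightarrow> complex" where
  "s_coeff n c a z k =
     - (\<Sum>l\<in>{1..n} - {k}. complex_of_real (c l) * xi c a z l) / (complex_of_real (c k) * xi c a z k)"

text \<open>The sign \<open>\<plusminus>\<close>, chosen by the half-plane in which the spectral parameter lies.\<close>

definition pm :: "complex \<Rightarrow> complex" where
  "pm z = (if Im z > 0 then 1 else - 1)"

text \<open>\<open>F n c a z j k x\<close> is the value at \<open>x\<close> on branch \<open>k\<close> of the function with upper index \<open>j\<close>.\<close>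

definition F :: "nat \<Rightarrow> (nat \<Rightarrow> real) \<Rightarrow> (nat \<Rightarrow> real) \<Rightarrow> complex \<Rightarrow> nat \<Rightarrow> nat \<Rightarrow> real \<Rightarrow> complex" where
  "F n c a z j k x =
     (if k = j
      then cos (xi c a z j * complex_of_real x) +
           pm z * \<i> * s_coeff n c a z j * sin (xi c a z j * complex_of_real x)
      else exp (pm z * \<i> * xi c a z k * complex_of_real x))"

definition w :: "nat \<Rightarrow> (nat \<Rightarrow> real) \<Rightarrow> (nat \<Rightarrow> real) \<Rightarrow> complex \<Rightarrow> complex" where
  "w n c a z = pm z * \<i> * (\<Sum>j=1..n. complex_of_real (c j) * xi c a z j)"

definition next_branch :: "nat \<Rightarrow> nat \<Rightarrow> nat" where
  "next_branch n j = (if j = n then 1 else j + 1)"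

text \<open>
  The kernel at \<open>x\<close> on branch \<open>j\<close> and \<open>x'\<close> on branch \<open>k\<close>.  On the diagonal both expressions
  have the same value.
\<close>

definition K :: "nat \<Rightarrow> (nat \<Rightarrow> real) \<Rightarrow> (nat \<Rightarrow> real) \<Rightarrow> complex \<Rightarrow> nat \<Rightarrow> real \<Rightarrow> nat \<Rightarrow> real \<Rightarrow> complex" where
  "K n c a z j x k x' =
     (if k = j \<and> x' > x
      then 1 / w n c a z * F n c a z j j x * F n c a z (next_branch n j) j x'
      else 1 / w n c a z * F n c a z (next_branch n j) j x * F n c a z j k x')"

end

theory Submission
  imports Defs
begin

text \<open>
  Put \<open>\<kappa> k = \<plusminus>\<i> \<xi> k\<close> with the sign of the theorem, so that \<open>Re (\<kappa> k) < 0\<close> as soon as \<open>z\<close> is not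
  real.  Instead of showing that the kernel integral lies in the domain of \<open>A\<close>, the solution
  \<open>u = R(z, A) f\<close> is taken as given and \<open>f k = c k u'' + (z - a k) u\<close> is integrated by parts against the
  two solutions of the homogeneous equation that make up the kernel.  The boundary terms at \<open>x\<close>
  reproduce \<open>u j x\<close> because the Wronskian there is \<open>w / c j\<close>, those at the vertex cancel by the
  transmission conditions, and those at infinity vanish by exponential decay.  Real \<open>z \<ge> a 1\<close> are not
  in the resolvent set: on the first branch a slowly decaying resonant right-hand side admits no
  square-integrable solution.
\<close>

section \<open>Integration on the half-line\<close>

text \<open>The obstacle is that \<open>op_A\<close> contains an arbitrarily chosen representative
  of the weak second derivative, known only through real test functions of class C1 supported away
  from the vertex, while the transmission conditions speak of the classical derivative
  \<open>p\<close> of \<open>u\<close>. The two are never identified: both weak derivatives are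
  moved onto a C2 test function, and one is moved back onto \<open>p\<close> by the fundamental
  theorem of calculus. Cut-offs converging to the indicator of an interval turn this into Green's
  formula with boundary terms. The interval is then extended to the vertex by continuity, and to
  infinity by square-integrability of \<open>u\<close> and of its weak second derivative, since no
  pointwise decay of \<open>u\<close> or \<open>p\<close> is at hand. The formula is derived for an
  arbitrary solution, hence for whichever one the choice in \<open>resolvent\<close> returns. That
  \<open>z\<close> is not real also settles \<open>w \<noteq> 0\<close>: \<open>w\<close> is the sum
  of the \<open>c k * \<kappa> k\<close>, all of negative real part, so nothing can cancel.\<close>

lemma L2_measurable: "g \<in> L2 \<Longrightarrow> g \<in> borel_measurable half_line"
  and L2_square_integrable: "g \<in> L2 \<Longrightarrow> integrable half_line (\<lambda>x. (cmod (g x))\<^sup>2)"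
  by (auto simp: L2_def)

lemma integrable_L2_mult:
  assumes "g \<in> L2" "h \<in> L2"
  shows "integrable half_line (\<lambda>x. g x * h x)"
proof (rule Bochner_Integration.integrable_bound)
  show "integrable half_line (\<lambda>x. (cmod (g x))\<^sup>2 + (cmod (h x))\<^sup>2)"
    using assms by (simp add: L2_square_integrable)
  show "(\<lambda>x. g x * h x) \<in> borel_measurable half_line"
    using assms by (intro borel_measurable_times L2_measurable)
  have "s * t \<le> \<bar>s\<^sup>2 + t\<^sup>2\<bar>" if "0 \<le> s" "0 \<le> t" for s t :: real
    using sum_squares_bound[of s t] mult_nonneg_nonneg[OF that] by linarith
  then show "AE x in half_line. norm (g x * h x) \<le> norm ((cmod (g x))\<^sup>2 + (cmod (h x))\<^sup>2)"
    by (intro AE_I2) (simp add: norm_mult)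
qed

lemma half_line_measurable_continuous:
  fixes \<psi> :: "real \<Rightarrow> 'a::topological_space"
  shows "continuous_on {0..} \<psi> \<Longrightarrow> \<psi> \<in> borel_measurable half_line"
  by (rule continuous_imp_measurable_on_sets_lebesgue) (auto intro: continuous_on_subset)

lemma half_line_measurable_indicator:
  assumes "A \<in> sets borel"
  shows "(indicator A :: real \<Rightarrow> 'a::{real_normed_algebra_1,second_countable_topology}) \<in> borel_measurable half_line"
proof -
  have "(indicator A :: real \<Rightarrow> 'a) \<in> borel_measurable lborel"
    using assms by simp
  then have "(indicator A :: real \<Rightarrow> 'a) \<in> borel_measurable lebesgue"
    by (rule measurable_completion)
  then show ?thesis
    by (rule measurable_restrict_space1)
qed

text \<open>Intervals are half-open throughout: \<open>{0<..x}\<close> and \<open>{x<..}\<close>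
  split the open half-line without overlap, and \<open>{a<..b}\<close> is the pointwise limit of the
  cut-offs used below.\<close>

lemma half_line_integrable_indicator:
  "integrable half_line (indicator {a<..b} :: real \<Rightarrow> real)"
proof -
  have "emeasure half_line ({a<..b} \<inter> space half_line) \<le> emeasure lebesgue {a<..b}"
    by (subst emeasure_restrict_space) (auto simp: space_restrict_space intro!: emeasure_mono)
  also have "\<dots> < \<infinity>"
  proof -
    have "bounded {a<..b}"
      by (rule bounded_subset[OF bounded_closed_interval[of a b]]) auto
    then have "emeasure lborel {a<..b} < \<infinity>"
      by (rule emeasure_bounded_finite)
    then show ?thesis
      by (subst emeasure_completion) simp_all
  qed
  finally have *: "emeasure half_line ({a<..b} \<inter> space half_line) < \<infinity>" .
  moreover have "{a<..b} \<inter> space half_line \<in> sets half_line"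
    by (subst sets_restrict_space) (auto simp: space_restrict_space image_iff intro!: bexI[of _ "{a<..b}"])
  ultimately show ?thesis
    by (simp add: integrable_indicator_iff)
qed

lemma continuous_bounded_Icc:
  fixes \<psi> :: "real \<Rightarrow> 'a::real_normed_vector"
  assumes "continuous_on {0..} \<psi>" "0 \<le> a"
  obtains B where "0 \<le> B" "\<And>x. x \<in> {a<..b} \<Longrightarrow> norm (\<psi> x) \<le> B"
proof -
  have "compact (\<psi> ` {a..b})"
    using assms by (intro compact_continuous_image) (auto intro: continuous_on_subset)
  then have "bounded (\<psi> ` {a..b})" by (rule compact_imp_bounded)
  then obtain B where "B > 0" "\<And>x. x \<in> {a..b} \<Longrightarrow> norm (\<psi> x) \<le> B"
    by (auto simp: bounded_pos)
  then show thesis by (intro that[of B]) auto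
qed

lemma L2_indicator:
  assumes "continuous_on {0..} \<psi>" "0 \<le> a"
  shows "(\<lambda>x. indicator {a<..b} x * \<psi> x) \<in> L2"
proof -
  obtain B where B: "0 \<le> B" "\<And>x. x \<in> {a<..b} \<Longrightarrow> cmod (\<psi> x) \<le> B"
    using continuous_bounded_Icc[OF assms] by metis
  have m: "(\<lambda>x. indicator {a<..b} x * \<psi> x) \<in> borel_measurable half_line"
    using assms by (intro borel_measurable_times half_line_measurable_indicator
        half_line_measurable_continuous) auto
  have "integrable half_line (\<lambda>x. (cmod (indicator {a<..b} x * \<psi> x))\<^sup>2)"
  proof (rule Bochner_Integration.integrable_bound)
    show "integrable half_line (\<lambda>x. B\<^sup>2 * indicator {a<..b} x :: real)"
      by (intro integrable_mult_right half_line_integrable_indicator)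
    show "(\<lambda>x. (cmod (indicator {a<..b} x * \<psi> x))\<^sup>2) \<in> borel_measurable half_line"
      using m by measurable
    show "AE x in half_line. norm ((cmod (indicator {a<..b} x * \<psi> x))\<^sup>2) \<le> norm (B\<^sup>2 * indicator {a<..b} x)"
      using B by (auto intro!: AE_I2 power_mono split: split_indicator)
  qed
  with m show ?thesis by (simp add: L2_def)
qed

lemma L2_mult_bounded:
  assumes "g \<in> L2" "\<psi> \<in> borel_measurable half_line" "\<And>x. x > 0 \<Longrightarrow> cmod (\<psi> x) \<le> B"
  shows "(\<lambda>x. \<psi> x * g x) \<in> L2"
proof -
  have m: "(\<lambda>x. \<psi> x * g x) \<in> borel_measurable half_line"
    using assms L2_measurable by auto
  have "integrable half_line (\<lambda>x. (cmod (\<psi> x * g x))\<^sup>2)"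
  proof (rule Bochner_Integration.integrable_bound)
    show "integrable half_line (\<lambda>x. B\<^sup>2 * (cmod (g x))\<^sup>2)"
      using assms by (simp add: L2_square_integrable)
    show "(\<lambda>x. (cmod (\<psi> x * g x))\<^sup>2) \<in> borel_measurable half_line"
      using m by measurable
    show "AE x in half_line. norm ((cmod (\<psi> x * g x))\<^sup>2) \<le> norm (B\<^sup>2 * (cmod (g x))\<^sup>2)"
      using assms(3)
      by (intro AE_I2) (auto simp: norm_mult power_mult_distrib intro!: mult_right_mono power_mono)
  qed
  with m show ?thesis by (simp add: L2_def)
qed

lemma integrable_continuous_indicator:
  assumes "continuous_on {0..} \<psi>" "0 \<le> a"
  shows "integrable half_line (\<lambda>x. indicator {a<..b} x * \<psi> x :: complex)"
proof -
  have "integrable half_line (\<lambda>x. (indicator {a<..b} x * \<psi> x) * (indicator {a<..b} x * 1))"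
    using assms by (intro integrable_L2_mult L2_indicator) auto
  then show ?thesis
    by (rule back_subst[where P="integrable half_line"]) (auto split: split_indicator)
qed

lemma integrable_continuous_mult_L2:
  assumes "continuous_on {0..} \<psi>" "0 \<le> a" "g \<in> L2"
  shows "integrable half_line (\<lambda>x. indicator {a<..b} x * (\<psi> x * g x))"
  using integrable_L2_mult[OF L2_indicator[OF assms(1,2), of b] assms(3)]
  by (simp add: mult.assoc)

lemma half_line_integral_eq_integral:
  assumes "continuous_on {0..} \<psi>" "0 \<le> a"
  shows "(\<integral>x. indicator {a<..b} x * \<psi> x \<partial>half_line) = (integral {a..b} \<psi> :: complex)"
proof -
  have "(\<integral>x. indicator {a<..b} x * \<psi> x \<partial>half_line) = integral {0<..} (\<lambda>x. indicator {a<..b} x * \<psi> x)"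
    using integrable_continuous_indicator[OF assms, of b]
    by (intro lebesgue_integral_eq_integral) auto
  also have "\<dots> = integral {0<..} (\<lambda>x. if x \<in> {a<..b} then \<psi> x else 0)"
    by (intro integral_cong) auto
  also have "\<dots> = integral ({a<..b} \<inter> {0<..}) \<psi>"
    by (rule integral_restrict_Int)
  also have "{a<..b} \<inter> {0<..} = {a<..b}"
    using assms(2) by auto
  also have "integral {a<..b} \<psi> = integral {a..b} \<psi>"
    by (rule integral_subset_negligible) (auto intro: negligible_subset[OF negligible_sing[of a]])
  finally show ?thesis .
qed

lemma half_line_FTC:
  assumes "continuous_on {0..} \<psi>'" "0 \<le> a" "a \<le> b"
    and "\<And>x. x \<ge> 0 \<Longrightarrow> (\<psi> has_vector_derivative \<psi>' x) (at x within {0..})"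
  shows "(\<integral>x. indicator {a<..b} x * \<psi>' x \<partial>half_line) = (\<psi> b - \<psi> a :: complex)"
proof -
  have "(\<psi>' has_integral (\<psi> b - \<psi> a)) {a..b}"
  proof (rule fundamental_theorem_of_calculus[OF assms(3)])
    fix x assume "x \<in> {a..b}"
    then show "(\<psi> has_vector_derivative \<psi>' x) (at x within {a..b})"
      using assms(2) by (intro has_vector_derivative_within_subset[OF assms(4)]) auto
  qed
  then show ?thesis
    using half_line_integral_eq_integral[OF assms(1,2)] by (metis integral_unique)
qed

section \<open>Weak derivatives and smooth steps\<close>

lemma test_functionI:
  fixes \<phi> \<phi>' :: "real \<Rightarrow> real"
  assumes der: "\<And>x. (\<phi> has_real_derivative \<phi>' x) (at x)" and cont: "continuous_on UNIV \<phi>'"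
    and zero: "\<And>x. x \<notin> {a..b} \<Longrightarrow> \<phi> x = 0" and "a > 0"
  shows "test_function \<phi>"
proof -
  have sub: "closure {x. \<phi> x \<noteq> 0} \<subseteq> {a..b}"
    using zero by (intro closure_minimal) (blast, simp)
  then have "bounded (closure {x. \<phi> x \<noteq> 0})"
    by (rule bounded_subset[rotated]) simp
  with sub show ?thesis
    using der cont \<open>a > 0\<close>
    unfolding test_function_def C1_differentiable_on_def compact_eq_bounded_closed
    by (auto simp: has_real_derivative_iff_has_vector_derivative intro!: exI[of _ \<phi>'])
qed

lemma weak_deriv_spec:
  assumes "u \<in> H1"
  shows "weak_deriv u \<in> L2" "is_weak_deriv u (weak_deriv u)"
proof -
  have "\<exists>g. g \<in> L2 \<and> is_weak_deriv u g"
    using assms by (auto simp: H1_def)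
  then have "weak_deriv u \<in> L2 \<and> is_weak_deriv u (weak_deriv u)"
    unfolding weak_deriv_def by (rule someI_ex)
  then show "weak_deriv u \<in> L2" "is_weak_deriv u (weak_deriv u)" by auto
qed

lemma H2_imp_L2: "u \<in> H2 \<Longrightarrow> u \<in> L2"
  by (simp add: H2_def H1_def)

lemma H2_second_deriv_L2: "u \<in> H2 \<Longrightarrow> weak_deriv (weak_deriv u) \<in> L2"
  by (simp add: H2_def weak_deriv_spec)

text \<open>The definition of the weak derivative is applied twice, with \<open>\<phi>\<close> and
  with \<open>\<phi>'\<close> as test functions; this is why \<open>\<phi>\<close> has to be of
  class C2. The two minus signs cancel, and the first weak derivative is only an intermediate that
  leaves no trace in the result.\<close>

lemma H2_weak_form:
  fixes \<phi> \<phi>' \<phi>'' :: "real \<Rightarrow> real"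
  assumes "u \<in> H2" "a > 0"
    and d1: "\<And>x. (\<phi> has_real_derivative \<phi>' x) (at x)"
    and d2: "\<And>x. (\<phi>' has_real_derivative \<phi>'' x) (at x)"
    and cont: "continuous_on UNIV \<phi>''"
    and zero: "\<And>x. x \<notin> {a..b} \<Longrightarrow> \<phi> x = 0" "\<And>x. x \<notin> {a..b} \<Longrightarrow> \<phi>' x = 0"
  shows "(\<integral>x. \<phi> x *\<^sub>R weak_deriv (weak_deriv u) x \<partial>half_line) = (\<integral>x. \<phi>'' x *\<^sub>R u x \<partial>half_line)"
proof -
  have u: "u \<in> H1" "weak_deriv u \<in> H1"
    using assms(1) by (auto simp: H2_def)
  have "continuous_on UNIV \<phi>'"
    using d2 by (intro DERIV_continuous_on[of UNIV]) auto
  then have t1: "test_function \<phi>"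
    using d1 zero(1) \<open>a > 0\<close> by (intro test_functionI[of \<phi> \<phi>' a b]) auto
  have t2: "test_function \<phi>'"
    using d2 cont zero(2) \<open>a > 0\<close> by (intro test_functionI[of \<phi>' \<phi>'' a b]) auto
  have e: "deriv \<phi> = \<phi>'" "deriv \<phi>' = \<phi>''"
    using d1 d2 by (auto intro!: ext DERIV_imp_deriv)
  show ?thesis
    using weak_deriv_spec(2)[OF u(1), unfolded is_weak_deriv_def, rule_format, OF t2]
      weak_deriv_spec(2)[OF u(2), unfolded is_weak_deriv_def, rule_format, OF t1]
    by (simp add: e)
qed

text \<open>A smooth step: a polynomial \<open>q\<close> with \<open>q' (0) = q' (1) = 0\<close> stays differentiable when its
  argument is clamped to \<open>[0, 1]\<close>, because clamping is Lipschitz.\<close>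

definition unit_clamp :: "real \<Rightarrow> real" where
  "unit_clamp x = max 0 (min 1 x)"

lemma unit_clamp_lipschitz: "\<bar>unit_clamp x - unit_clamp y\<bar> \<le> \<bar>x - y\<bar>"
  by (auto simp: unit_clamp_def max_def min_def)

lemma continuous_on_unit_clamp [continuous_intros]:
  "continuous_on S f \<Longrightarrow> continuous_on S (\<lambda>x. unit_clamp (f x))"
  unfolding unit_clamp_def by (intro continuous_intros)

lemma DERIV_comp_unit_clamp:
  fixes q q' :: "real \<Rightarrow> real"
  assumes q: "\<And>x. (q has_real_derivative q' x) (at x)" and "q' 0 = 0" "q' 1 = 0"
  shows "((\<lambda>x. q (unit_clamp x)) has_real_derivative q' (unit_clamp x)) (at x)"
proof (cases "x \<in> {0<..<1}")
  case True
  have "((\<lambda>x. q (unit_clamp x)) has_real_derivative q' x) (at x) \<longleftrightarrow> (q has_real_derivative q' x) (at x)"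
  proof (rule has_field_derivative_cong_ev)
    have "\<forall>\<^sub>F y in nhds x. y \<in> {0<..<1}"
      using True by (intro eventually_nhds_in_open) auto
    then show "\<forall>\<^sub>F y in nhds x. y \<in> UNIV \<longrightarrow> q (unit_clamp y) = q y"
      by eventually_elim (auto simp: unit_clamp_def)
  qed (use True in \<open>auto simp: unit_clamp_def\<close>)
  with True q show ?thesis by (simp add: unit_clamp_def)
next
  case False
  then have z: "q' (unit_clamp x) = 0"
    using assms(2,3) by (auto simp: unit_clamp_def max_def min_def)
  define c where "c = unit_clamp x"
  have "((\<lambda>x. q (unit_clamp x)) has_derivative (\<lambda>h. 0)) (at x)"
    unfolding has_derivative_at_alt
  proof (intro conjI allI impI)
    fix e :: real assume "e > 0"
    have "(q has_derivative (\<lambda>h. 0)) (at c)"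
      using q[of c] z by (simp add: has_field_derivative_def c_def lambda_zero)
    then obtain d where d: "d > 0" "\<And>y. norm (y - c) < d \<Longrightarrow> norm (q y - q c) \<le> e * norm (y - c)"
      unfolding has_derivative_at_alt using \<open>e > 0\<close> by auto
    have "norm (q (unit_clamp y) - q (unit_clamp x) - 0) \<le> e * norm (y - x)" if "norm (y - x) < d" for y
    proof -
      have l: "norm (unit_clamp y - c) \<le> norm (y - x)"
        using unit_clamp_lipschitz[of y x] by (simp add: c_def)
      then have "norm (q (unit_clamp y) - q c) \<le> e * norm (unit_clamp y - c)"
        using that by (intro d(2)) linarith
      also have "\<dots> \<le> e * norm (y - x)"
        using l \<open>e > 0\<close> by (intro mult_left_mono) auto
      finally show ?thesis by (simp add: c_def)
    qed
    then show "\<exists>d>0. \<forall>y. norm (y - x) < d \<longrightarrow> norm (q (unit_clamp y) - q (unit_clamp x) - 0) \<le> e * norm (y - x)"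
      using d(1) by blast
  qed simp
  then show ?thesis
    using z by (simp add: has_field_derivative_def lambda_zero)
qed

text \<open>The polynomial \<open>30 * x^2 * (1 - x)^2\<close> has integral 1 over
  \<open>[0, 1]\<close> and double zeros at both ends; this quintic is its antiderivative. After
  clamping it is of class C2, just what \<open>H2_weak_form\<close> asks for.\<close>

definition step0 :: "real \<Rightarrow> real" where
  "step0 x = 10 * unit_clamp x ^ 3 - 15 * unit_clamp x ^ 4 + 6 * unit_clamp x ^ 5"
definition step1 :: "real \<Rightarrow> real" where
  "step1 x = 30 * (unit_clamp x ^ 2 * (1 - unit_clamp x) ^ 2)"
definition step2 :: "real \<Rightarrow> real" where
  "step2 x = 60 * (unit_clamp x * (1 - unit_clamp x) * (1 - 2 * unit_clamp x))"

lemma DERIV_step0: "(step0 has_real_derivative step1 x) (at x)"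
proof -
  have "((\<lambda>x. 10 * x ^ 3 - 15 * x ^ 4 + 6 * x ^ 5) has_real_derivative 30 * (x ^ 2 * (1 - x) ^ 2)) (at x)"
    for x :: real
    by (auto intro!: derivative_eq_intros simp: power2_eq_square power3_eq_cube eval_nat_numeral algebra_simps)
  from DERIV_comp_unit_clamp[OF this] show ?thesis
    by (simp add: step0_def[abs_def] step1_def)
qed

lemma DERIV_step1: "(step1 has_real_derivative step2 x) (at x)"
proof -
  have "((\<lambda>x. 30 * (x ^ 2 * (1 - x) ^ 2)) has_real_derivative 60 * (x * (1 - x) * (1 - 2 * x))) (at x)"
    for x :: real
    by (auto intro!: derivative_eq_intros simp: power2_eq_square algebra_simps)
  from DERIV_comp_unit_clamp[OF this] show ?thesis
    by (simp add: step1_def[abs_def] step2_def)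
qed

lemma continuous_on_step:
  "continuous_on S step0" "continuous_on S step1" "continuous_on S step2"
  unfolding step0_def[abs_def] step1_def[abs_def] step2_def[abs_def]
  by (intro continuous_intros)+

lemma step_outside:
  "x \<le> 0 \<Longrightarrow> step0 x = 0" "x \<ge> 1 \<Longrightarrow> step0 x = 1"
  "x \<le> 0 \<Longrightarrow> step1 x = 0" "x \<ge> 1 \<Longrightarrow> step1 x = 0"
  by (auto simp: step0_def step1_def unit_clamp_def)

lemma step1_nonneg: "step1 x \<ge> 0"
  by (simp add: step1_def)

lemma step0_range: "0 \<le> step0 x" "step0 x \<le> 1"
proof -
  have m: "mono step0"
  proof (rule monoI)
    fix x y :: real assume "x \<le> y"
    then show "step0 x \<le> step0 y"
      by (rule DERIV_nonneg_imp_nondecreasing) (use DERIV_step0 step1_nonneg in blast)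
  qed
  from monoD[OF m, of "min x 0" x] monoD[OF m, of x "max x 1"]
  show "0 \<le> step0 x" "step0 x \<le> 1" by (auto simp: step_outside)
qed

text \<open>The rescaled \<open>step1\<close> is an approximate identity of mass 1 living on
  \<open>[a, a + 1 / Suc m]\<close>. It lies to the right of \<open>a\<close>, so continuity of
  \<open>r\<close> on the closed half-line suffices even at \<open>a = 0\<close>. The gap
  \<open>a + 1 \<le> b\<close> leaves room for the whole mass for every \<open>m\<close>.\<close>

lemma step_delta_limit:
  fixes r :: "real \<Rightarrow> complex"
  assumes r: "continuous_on {0..} r" and "0 \<le> a" "a + 1 \<le> b"
  shows "(\<lambda>m. \<integral>x. indicator {a<..b} x * (of_real (real (Suc m) * step1 (real (Suc m) * (x - a))) * r x) \<partial>half_line)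
     \<longlonglongrightarrow> r a"
proof (rule LIMSEQ_I)
  fix e :: real assume "e > 0"
  have "continuous (at a within {0..}) r"
    using r \<open>0 \<le> a\<close> by (simp add: continuous_on_eq_continuous_within)
  then obtain d where d: "d > 0" "\<And>y. y \<ge> 0 \<Longrightarrow> dist y a < d \<Longrightarrow> dist (r y) (r a) < e/2"
    unfolding continuous_within_eps_delta using \<open>e > 0\<close> by (metis atLeast_iff half_gt_zero)
  obtain M where M: "inverse (real (Suc M)) < d"
    using reals_Archimedean[OF d(1)] by blast
  show "\<exists>no. \<forall>m\<ge>no. norm ((\<integral>x. indicator {a<..b} x * (of_real (real (Suc m) * step1 (real (Suc m) * (x - a))) * r x) \<partial>half_line) - r a) < e"
  proof (intro exI allI impI)
    fix m assume "M \<le> m"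
    define k where "k = real (Suc m)"
    have k: "k \<ge> 1" "k \<ge> real (Suc M)" using \<open>M \<le> m\<close> by (auto simp: k_def)
    have kd: "1 / k < d"
    proof -
      have "1 / k \<le> inverse (real (Suc M))"
        using k by (simp add: inverse_eq_divide frac_le)
      with M show ?thesis by linarith
    qed
    define \<delta> where "\<delta> x = k * step1 (k * (x - a))" for x
    have cont_\<delta>: "continuous_on S \<delta>" for S
      unfolding \<delta>_def by (intro continuous_intros continuous_on_compose2[OF continuous_on_step(2)[of UNIV]]) auto
    have \<delta>0: "\<delta> x \<ge> 0" for x
      using k step1_nonneg by (simp add: \<delta>_def)
    have one: "(\<delta> has_integral 1) {a..b}"
    proof -
      have "(\<delta> has_integral step0 (k * (b - a)) - step0 (k * (a - a))) {a..b}"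
      proof (rule fundamental_theorem_of_calculus)
        fix x assume "x \<in> {a..b}"
        have "((\<lambda>x. step0 (k * (x - a))) has_real_derivative step1 (k * (x - a)) * k) (at x)"
          by (rule DERIV_chain2[OF DERIV_step0]) (auto intro!: derivative_eq_intros)
        then show "((\<lambda>x. step0 (k * (x - a))) has_vector_derivative \<delta> x) (at x within {a..b})"
          by (auto simp: \<delta>_def has_real_derivative_iff_has_vector_derivative mult.commute
              intro: has_vector_derivative_at_within)
      qed (use \<open>a + 1 \<le> b\<close> in auto)
      moreover have "k * (b - a) \<ge> 1 * 1"
        using k assms(3) by (intro mult_mono) auto
      ultimately show ?thesis by (simp add: step_outside)
    qed
    have r': "continuous_on {a..b} r"
      using r \<open>0 \<le> a\<close> by (auto intro: continuous_on_subset)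
    have i1: "(\<lambda>x. of_real (\<delta> x) * r x) integrable_on {a..b}"
      by (intro integrable_continuous_real continuous_intros cont_\<delta> r')
    have i2: "((\<lambda>x. of_real (\<delta> x) * r a) has_integral of_real 1 * r a) {a..b}"
      by (intro has_integral_mult_left has_integral_of_real one)
    have i3: "((\<lambda>x. of_real (\<delta> x) * r x - of_real (\<delta> x) * r a) has_integral
        integral {a..b} (\<lambda>x. of_real (\<delta> x) * r x) - r a) {a..b}"
      using has_integral_diff[OF integrable_integral[OF i1] i2] by simp
    have i4: "((\<lambda>x. \<delta> x * (e/2)) has_integral 1 * (e/2)) {a..b}"
      by (intro has_integral_mult_left one)
    have "norm (integral {a..b} (\<lambda>x. of_real (\<delta> x) * r x - of_real (\<delta> x) * r a))
        \<le> integral {a..b} (\<lambda>x. \<delta> x * (e/2))"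
    proof (rule integral_norm_bound_integral)
      fix x assume x: "x \<in> {a..b}"
      show "norm (of_real (\<delta> x) * r x - of_real (\<delta> x) * r a) \<le> \<delta> x * (e/2)"
      proof (cases "x < a + 1 / k")
        case True
        then have "norm (r x - r a) < e/2"
          using x kd d(2)[of x] \<open>0 \<le> a\<close> by (auto simp: dist_norm)
        then show ?thesis
          using mult_left_mono[OF less_imp_le \<delta>0[of x], of "norm (r x - r a)" "e/2"] \<delta>0[of x]
          by (simp add: norm_mult flip: right_diff_distrib)
      next
        case False
        then have "k * (x - a) \<ge> 1"
          using k by (simp add: field_simps)
        then show ?thesis by (simp add: \<delta>_def step_outside)
      qed
    qed (use i3 i4 in \<open>auto simp: has_integral_integrable\<close>)
    then have "norm (integral {a..b} (\<lambda>x. of_real (\<delta> x) * r x) - r a) \<le> e/2"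
      using integral_unique[OF i3] integral_unique[OF i4] \<open>e > 0\<close> by auto
    moreover have "(\<integral>x. indicator {a<..b} x * (of_real (\<delta> x) * r x) \<partial>half_line)
        = integral {a..b} (\<lambda>x. of_real (\<delta> x) * r x)"
      by (intro half_line_integral_eq_integral continuous_intros cont_\<delta> r assms(2))
    ultimately show "norm ((\<integral>x. indicator {a<..b} x * (of_real (real (Suc m) * step1 (real (Suc m) * (x - a))) * r x) \<partial>half_line) - r a) < e"
      using \<open>e > 0\<close> by (simp add: \<delta>_def k_def)
  qed
qed

section \<open>Twice differentiable cut-offs of an interval\<close>

text \<open>The rise starts at \<open>a\<close> and the fall starts at \<open>b\<close>. The support
  thus stays in the open half-line once \<open>a > 0\<close>, and it ends before
  \<open>b + 1\<close> for every \<open>m\<close>, which explains the windows up to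
  \<open>b + 1\<close> below. Each step is still 0 at its own starting point, hence the half-open
  limit interval.\<close>

definition cutoff :: "real \<Rightarrow> real \<Rightarrow> nat \<Rightarrow> real \<Rightarrow> real" where
  "cutoff a b m x = step0 (real (Suc m) * (x - a)) - step0 (real (Suc m) * (x - b))"

definition cutoff' :: "real \<Rightarrow> real \<Rightarrow> nat \<Rightarrow> real \<Rightarrow> real" where
  "cutoff' a b m x = real (Suc m) * step1 (real (Suc m) * (x - a)) - real (Suc m) * step1 (real (Suc m) * (x - b))"

definition cutoff'' :: "real \<Rightarrow> real \<Rightarrow> nat \<Rightarrow> real \<Rightarrow> real" where
  "cutoff'' a b m x = (real (Suc m))\<^sup>2 * step2 (real (Suc m) * (x - a)) - (real (Suc m))\<^sup>2 * step2 (real (Suc m) * (x - b))"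

lemma step2_outside: "x \<le> 0 \<Longrightarrow> step2 x = 0" "x \<ge> 1 \<Longrightarrow> step2 x = 0"
  by (auto simp: step2_def unit_clamp_def)

lemma DERIV_cutoff: "(cutoff a b m has_real_derivative cutoff' a b m x) (at x)"
  unfolding cutoff_def[abs_def] cutoff'_def
  by (auto intro!: derivative_eq_intros DERIV_chain2[OF DERIV_step0])

lemma DERIV_cutoff': "(cutoff' a b m has_real_derivative cutoff'' a b m x) (at x)"
  unfolding cutoff'_def[abs_def] cutoff''_def
  by (auto intro!: derivative_eq_intros DERIV_chain2[OF DERIV_step1] simp: power2_eq_square algebra_simps)

lemma continuous_on_cutoff:
  "continuous_on S (cutoff a b m)" "continuous_on S (cutoff' a b m)" "continuous_on S (cutoff'' a b m)"
  unfolding cutoff_def[abs_def] cutoff'_def[abs_def] cutoff''_def[abs_def]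
  by (intro continuous_intros continuous_on_compose2[OF continuous_on_step(1)[of UNIV]]
       continuous_on_compose2[OF continuous_on_step(2)[of UNIV]]
       continuous_on_compose2[OF continuous_on_step(3)[of UNIV]]; simp)+

lemma cutoff_outside:
  assumes "a < b" "x \<le> a \<or> b + 1 \<le> x"
  shows "cutoff a b m x = 0" "cutoff' a b m x = 0" "cutoff'' a b m x = 0"
proof -
  define k where "k = real (Suc m)"
  have k: "k \<ge> 1" by (simp add: k_def)
  have "(k * (x - a) \<le> 0 \<and> k * (x - b) \<le> 0) \<or> (k * (x - a) \<ge> 1 \<and> k * (x - b) \<ge> 1)"
    using assms(2)
  proof
    assume "x \<le> a"
    then show ?thesis using k \<open>a < b\<close> by (simp add: mult_nonneg_nonpos)
  next
    assume "b + 1 \<le> x"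
    then have "k * (x - a) \<ge> 1 * 1" "k * (x - b) \<ge> 1 * 1"
      using k \<open>a < b\<close> by (intro mult_mono; simp)+
    then show ?thesis by simp
  qed
  then show "cutoff a b m x = 0" "cutoff' a b m x = 0" "cutoff'' a b m x = 0"
    unfolding cutoff_def cutoff'_def cutoff''_def k_def[symmetric]
    by (auto simp: step_outside step2_outside)
qed

lemma cutoff_bound: "\<bar>cutoff a b m x\<bar> \<le> 1"
  using step0_range[of "real (Suc m) * (x - a)"] step0_range[of "real (Suc m) * (x - b)"]
  by (simp add: cutoff_def abs_le_iff)

lemma step0_tendsto:
  "(\<lambda>m. step0 (real (Suc m) * (x - a))) \<longlonglongrightarrow> indicator {a<..} x"
proof (cases "x \<le> a")
  case True
  then have "step0 (real (Suc m) * (x - a)) = 0" for m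
    by (intro step_outside mult_nonneg_nonpos) auto
  then show ?thesis using True by simp
next
  case False
  then obtain M where M: "inverse (real (Suc M)) < x - a"
    using reals_Archimedean[of "x - a"] by auto
  have "\<forall>\<^sub>F m in sequentially. step0 (real (Suc m) * (x - a)) = 1"
    using eventually_ge_at_top[of M]
  proof eventually_elim
    fix m assume "M \<le> m"
    have "1 = inverse (real (Suc M)) * real (Suc M)" by simp
    also have "\<dots> \<le> (x - a) * real (Suc m)"
      using M \<open>M \<le> m\<close> False by (intro mult_mono) auto
    finally show "step0 (real (Suc m) * (x - a)) = 1"
      by (intro step_outside) (simp add: mult.commute)
  qed
  then have "(\<lambda>m. step0 (real (Suc m) * (x - a))) \<longlonglongrightarrow> 1"
    by (rule tendsto_eventually)
  then show ?thesis using False by simp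
qed

lemma cutoff_tendsto:
  assumes "a < b"
  shows "(\<lambda>m. cutoff a b m x) \<longlonglongrightarrow> indicator {a<..b} x"
proof -
  have "(\<lambda>m. cutoff a b m x) \<longlonglongrightarrow> indicator {a<..} x - indicator {b<..} x"
    unfolding cutoff_def by (intro tendsto_diff step0_tendsto)
  also have "indicator {a<..} x - indicator {b<..} x = (indicator {a<..b} x :: real)"
    using assms by (auto split: split_indicator)
  finally show ?thesis .
qed

text \<open>Dominated convergence. Only integrability of \<open>g\<close> up to \<open>b + 1\<close>
  is available; the cut-offs vanish outside that window, so the indicator does not alter the
  integrand and supplies the majorant.\<close>

lemma cutoff_integral_tendsto:
  fixes g :: "real \<Rightarrow> complex"
  assumes "a < b" and g: "integrable half_line (\<lambda>x. indicator {a<..b+1} x * g x)"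
  shows "(\<lambda>m. \<integral>x. of_real (cutoff a b m x) * (indicator {a<..b+1} x * g x) \<partial>half_line)
      \<longlonglongrightarrow> (\<integral>x. indicator {a<..b} x * g x \<partial>half_line)"
proof -
  let ?G = "\<lambda>x. indicator {a<..b+1} x * g x"
  have "(\<lambda>m. \<integral>x. of_real (cutoff a b m x) * ?G x \<partial>half_line)
      \<longlonglongrightarrow> (\<integral>x. indicator {a<..b} x * ?G x \<partial>half_line)"
  proof (rule integral_dominated_convergence)
    show "integrable half_line (\<lambda>x. norm (?G x))"
      using g by (rule integrable_norm)
    show "(\<lambda>x. indicator {a<..b} x * ?G x) \<in> borel_measurable half_line"
      by (intro borel_measurable_times[OF _ borel_measurable_integrable[OF g]] half_line_measurable_indicator) auto
    show "(\<lambda>x. of_real (cutoff a b m x) * ?G x) \<in> borel_measurable half_line" for m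
      by (intro borel_measurable_times[OF _ borel_measurable_integrable[OF g]]
          half_line_measurable_continuous continuous_intros continuous_on_cutoff)
    show "AE x in half_line. (\<lambda>m. of_real (cutoff a b m x) * ?G x) \<longlonglongrightarrow> indicator {a<..b} x * ?G x"
    proof (intro AE_I2)
      fix x
      have "(\<lambda>m. of_real (cutoff a b m x) * ?G x) \<longlonglongrightarrow> of_real (indicator {a<..b} x) * ?G x"
        by (intro tendsto_intros cutoff_tendsto assms(1))
      then show "(\<lambda>m. of_real (cutoff a b m x) * ?G x) \<longlonglongrightarrow> indicator {a<..b} x * ?G x"
        by (simp add: of_real_indicator)
    qed
    show "AE x in half_line. norm (of_real (cutoff a b m x) * ?G x) \<le> norm (?G x)" for m
      using cutoff_bound by (intro AE_I2) (simp add: norm_mult mult_left_le_one_le)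
  qed
  moreover have "indicator {a<..b} x * ?G x = indicator {a<..b} x * g x" for x
    by (auto split: split_indicator)
  ultimately show ?thesis by simp
qed

text \<open>The derivative of the cut-off is an approximate identity at \<open>a\<close> minus one
  at \<open>b\<close>.\<close>

lemma cutoff'_integral_tendsto:
  fixes r :: "real \<Rightarrow> complex"
  assumes "0 \<le> a" "a < b" and r: "continuous_on {0..} r"
  shows "(\<lambda>m. \<integral>x. indicator {a<..b+1} x * (of_real (cutoff' a b m x) * r x) \<partial>half_line)
      \<longlonglongrightarrow> r a - r b"
proof -
  let ?\<delta> = "\<lambda>c m x. of_real (real (Suc m) * step1 (real (Suc m) * (x - c))) * r x"
  have cont: "continuous_on {0..} (?\<delta> c m)" for c m
    by (intro continuous_intros r continuous_on_compose2[OF continuous_on_step(2)[of UNIV]]) auto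
  have "(\<integral>x. indicator {a<..b+1} x * (of_real (cutoff' a b m x) * r x) \<partial>half_line)
     = (\<integral>x. indicator {a<..b+1} x * ?\<delta> a m x \<partial>half_line)
       - (\<integral>x. indicator {b<..b+1} x * ?\<delta> b m x \<partial>half_line)" for m
  proof -
    \<comment> \<open>The part concentrated at \<open>b\<close> vanishes up to \<open>b\<close>, so
      its window can be shortened to one that starts at \<open>b\<close>, as
      \<open>step_delta_limit\<close> requires.\<close>
    have "indicator {a<..b+1} x * (of_real (cutoff' a b m x) * r x)
       = indicator {a<..b+1} x * ?\<delta> a m x - indicator {b<..b+1} x * ?\<delta> b m x" for x
    proof (cases "x \<le> b")
      case True
      then have "step1 (real (Suc m) * (x - b)) = 0"
        by (intro step_outside mult_nonneg_nonpos) auto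
      with True show ?thesis by (simp add: cutoff'_def)
    next
      case False
      then show ?thesis using \<open>a < b\<close>
        by (auto simp: cutoff'_def algebra_simps split: split_indicator)
    qed
    then show ?thesis
      using assms(1,2)
      by (simp only: Bochner_Integration.integral_diff[symmetric] integrable_continuous_indicator[OF cont])
  qed
  then show ?thesis
    using assms by (simp only:) (intro tendsto_diff step_delta_limit; simp)
qed

section \<open>Integration by parts against the weak second derivative\<close>

text \<open>With \<open>\<psi>\<close> times a cut-off as test function, the weak formula takes two
  derivatives off \<open>u\<close>, and the fundamental theorem gives one back as \<open>p\<close>.
  The boundary terms arise in the limit from the derivative of the cut-off. Test functions are real
  and supported away from the vertex, hence a real \<open>\<psi>\<close> and \<open>a > 0\<close> at
  this stage.\<close>

lemma green_real:
  fixes \<psi> \<psi>' \<psi>'' :: "real \<Rightarrow> real" and u p :: "real \<Rightarrow> complex"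
  assumes u: "u \<in> H2" and p: "continuous_on {0..} p"
    and up: "\<And>x. x \<ge> 0 \<Longrightarrow> (u has_vector_derivative p x) (at x within {0..})"
    and d1: "\<And>x. (\<psi> has_real_derivative \<psi>' x) (at x)"
    and d2: "\<And>x. (\<psi>' has_real_derivative \<psi>'' x) (at x)"
    and cont2: "continuous_on UNIV \<psi>''"
    and ab: "0 < a" "a < b"
  shows "(\<integral>x. indicator {a<..b} x * (of_real (\<psi> x) * weak_deriv (weak_deriv u) x) \<partial>half_line)
     = of_real (\<psi> b) * p b - of_real (\<psi> a) * p a
       - (\<integral>x. indicator {a<..b} x * (of_real (\<psi>' x) * p x) \<partial>half_line)"
proof -
  define h where "h = weak_deriv (weak_deriv u)"
  have h: "h \<in> L2" using u by (simp add: h_def H2_second_deriv_L2)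
  have cont1: "continuous_on UNIV \<psi>'" using d2 by (intro DERIV_continuous_on[of UNIV]) auto
  have cont0: "continuous_on UNIV \<psi>" using d1 by (intro DERIV_continuous_on[of UNIV]) auto
  note cont = cont0[THEN continuous_on_subset, OF subset_UNIV] cont1[THEN continuous_on_subset, OF subset_UNIV]
    cont2[THEN continuous_on_subset, OF subset_UNIV]
  have contu: "continuous_on {0..} u"
    using up by (intro continuous_on_vector_derivative) auto
  let ?I = "indicator {a<..b+1} :: real \<Rightarrow> complex"
  let ?c = "cutoff a b" and ?c' = "cutoff' a b" and ?c'' = "cutoff'' a b"
  have step: "(\<integral>x. of_real (?c m x) * (?I x * (of_real (\<psi> x) * h x)) \<partial>half_line)
      = - (\<integral>x. of_real (?c m x) * (?I x * (of_real (\<psi>' x) * p x)) \<partial>half_line)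
        - (\<integral>x. ?I x * (of_real (?c' m x) * (of_real (\<psi> x) * p x)) \<partial>half_line)" for m
  proof -
    define \<phi> where "\<phi> x = \<psi> x * ?c m x" for x
    define \<phi>' where "\<phi>' x = \<psi>' x * ?c m x + \<psi> x * ?c' m x" for x
    define \<phi>'' where "\<phi>'' x = \<psi>'' x * ?c m x + 2 * \<psi>' x * ?c' m x + \<psi> x * ?c'' m x" for x
    have e1: "(\<phi> has_real_derivative \<phi>' x) (at x)" for x
      unfolding \<phi>_def[abs_def] \<phi>'_def
      by (auto intro!: derivative_eq_intros d1 DERIV_cutoff)
    have e2: "(\<phi>' has_real_derivative \<phi>'' x) (at x)" for x
      unfolding \<phi>'_def[abs_def] \<phi>''_def
      by (auto intro!: derivative_eq_intros d1 d2 DERIV_cutoff DERIV_cutoff')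
    have c'': "continuous_on S \<phi>''" for S
      unfolding \<phi>''_def[abs_def] by (intro continuous_intros cont continuous_on_cutoff)
    have c': "continuous_on S \<phi>'" for S
      unfolding \<phi>'_def[abs_def] by (intro continuous_intros cont continuous_on_cutoff)
    have z: "\<phi> x = 0" "\<phi>' x = 0" "\<phi>'' x = 0" if "x \<le> a \<or> b + 1 \<le> x" for x
      using cutoff_outside[OF ab(2) that] by (auto simp: \<phi>_def \<phi>'_def \<phi>''_def)
    have "(\<integral>x. of_real (?c m x) * (?I x * (of_real (\<psi> x) * h x)) \<partial>half_line)
        = (\<integral>x. \<phi> x *\<^sub>R h x \<partial>half_line)"
      by (intro Bochner_Integration.integral_cong refl)
         (use cutoff_outside(1)[OF ab(2)] in \<open>auto simp: \<phi>_def scaleR_conv_of_real split: split_indicator\<close>)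
    also have "\<dots> = (\<integral>x. \<phi>'' x *\<^sub>R u x \<partial>half_line)"
      unfolding h_def using z e1 e2 c'' ab by (intro H2_weak_form[OF u, of a _ \<phi>' _ "b+1"]) auto
    also have "\<dots> = (\<integral>x. ?I x * (of_real (\<phi>'' x) * u x) \<partial>half_line)"
      by (intro Bochner_Integration.integral_cong refl)
         (use z(3) in \<open>auto simp: scaleR_conv_of_real split: split_indicator\<close>)
    \<comment> \<open>\<open>\<phi>'\<close> vanishes at both ends of the window, so this classical
      integration by parts has no boundary terms.\<close>
    also have "\<dots> = - (\<integral>x. ?I x * (of_real (\<phi>' x) * p x) \<partial>half_line)"
    proof -
      have "(\<integral>x. ?I x * (of_real (\<phi>'' x) * u x + of_real (\<phi>' x) * p x) \<partial>half_line)
          = of_real (\<phi>' (b+1)) * u (b+1) - of_real (\<phi>' a) * u a"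
      proof (rule half_line_FTC)
        show "continuous_on {0..} (\<lambda>x. of_real (\<phi>'' x) * u x + of_real (\<phi>' x) * p x)"
          by (intro continuous_intros c' c'' contu p)
        fix x :: real assume "x \<ge> 0"
        have "((\<lambda>x. \<phi>' x *\<^sub>R u x) has_vector_derivative \<phi>' x *\<^sub>R p x + \<phi>'' x *\<^sub>R u x) (at x within {0..})"
          using e2[of x] up[OF \<open>x \<ge> 0\<close>]
          by (intro has_vector_derivative_scaleR) (auto intro: has_field_derivative_at_within)
        then show "((\<lambda>x. of_real (\<phi>' x) * u x) has_vector_derivative
            of_real (\<phi>'' x) * u x + of_real (\<phi>' x) * p x) (at x within {0..})"
          by (simp add: scaleR_conv_of_real add.commute)
      qed (use ab in auto)
      also have "\<dots> = 0" using z by simp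
      also have "(\<integral>x. ?I x * (of_real (\<phi>'' x) * u x + of_real (\<phi>' x) * p x) \<partial>half_line)
        = (\<integral>x. ?I x * (of_real (\<phi>'' x) * u x) \<partial>half_line)
          + (\<integral>x. ?I x * (of_real (\<phi>' x) * p x) \<partial>half_line)"
        unfolding distrib_left using ab
        by (intro Bochner_Integration.integral_add integrable_continuous_indicator continuous_intros
            c' c'' contu p) auto
      finally show ?thesis by (simp add: add_eq_0_iff2)
    qed
    also have "(\<integral>x. ?I x * (of_real (\<phi>' x) * p x) \<partial>half_line)
        = (\<integral>x. ?I x * (of_real (?c m x) * (of_real (\<psi>' x) * p x))
             + ?I x * (of_real (?c' m x) * (of_real (\<psi> x) * p x)) \<partial>half_line)"
      by (intro Bochner_Integration.integral_cong refl) (simp add: \<phi>'_def algebra_simps)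
    also have "\<dots> = (\<integral>x. ?I x * (of_real (?c m x) * (of_real (\<psi>' x) * p x)) \<partial>half_line)
          + (\<integral>x. ?I x * (of_real (?c' m x) * (of_real (\<psi> x) * p x)) \<partial>half_line)"
      using ab
      by (intro Bochner_Integration.integral_add integrable_continuous_indicator continuous_intros
            cont continuous_on_cutoff p) auto
    finally show ?thesis by (simp add: mult.left_commute)
  qed
  have "(\<lambda>m. \<integral>x. of_real (?c m x) * (?I x * (of_real (\<psi> x) * h x)) \<partial>half_line)
      \<longlonglongrightarrow> (\<integral>x. indicator {a<..b} x * (of_real (\<psi> x) * h x) \<partial>half_line)"
    using ab h by (intro cutoff_integral_tendsto integrable_continuous_mult_L2 continuous_intros cont) auto
  moreover have "(\<lambda>m. \<integral>x. of_real (?c m x) * (?I x * (of_real (\<psi> x) * h x)) \<partial>half_line)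
      \<longlonglongrightarrow> - (\<integral>x. indicator {a<..b} x * (of_real (\<psi>' x) * p x) \<partial>half_line)
         - (of_real (\<psi> a) * p a - of_real (\<psi> b) * p b)"
    unfolding step using ab
    by (intro tendsto_diff tendsto_minus cutoff_integral_tendsto cutoff'_integral_tendsto
        integrable_continuous_indicator continuous_intros cont p) auto
  ultimately have "(\<integral>x. indicator {a<..b} x * (of_real (\<psi> x) * h x) \<partial>half_line)
      = - (\<integral>x. indicator {a<..b} x * (of_real (\<psi>' x) * p x) \<partial>half_line)
         - (of_real (\<psi> a) * p a - of_real (\<psi> b) * p b)"
    by (rule LIMSEQ_unique)
  then show ?thesis by (simp add: h_def)
qed

text \<open>A complex \<open>\<psi>\<close> is split into real and imaginary parts while
  \<open>u\<close> stays complex. A second, purely classical integration by parts, of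
  \<open>\<psi>' * p\<close>, then produces the term with \<open>\<psi>''\<close>.\<close>

lemma green_complex:
  fixes \<psi> \<psi>' \<psi>'' :: "real \<Rightarrow> complex" and u p :: "real \<Rightarrow> complex"
  assumes u: "u \<in> H2" and p: "continuous_on {0..} p"
    and up: "\<And>x. x \<ge> 0 \<Longrightarrow> (u has_vector_derivative p x) (at x within {0..})"
    and d1: "\<And>x. (\<psi> has_vector_derivative \<psi>' x) (at x)"
    and d2: "\<And>x. (\<psi>' has_vector_derivative \<psi>'' x) (at x)"
    and cont2: "continuous_on UNIV \<psi>''"
    and ab: "0 < a" "a < b"
  shows "(\<integral>x. indicator {a<..b} x * (\<psi> x * weak_deriv (weak_deriv u) x) \<partial>half_line)
     = (\<psi> b * p b - \<psi>' b * u b) - (\<psi> a * p a - \<psi>' a * u a)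
       + (\<integral>x. indicator {a<..b} x * (\<psi>'' x * u x) \<partial>half_line)"
proof -
  define h where "h = weak_deriv (weak_deriv u)"
  have h: "h \<in> L2" using u by (simp add: h_def H2_second_deriv_L2)
  have cont1: "continuous_on S \<psi>'" for S
    using d2 by (intro continuous_on_vector_derivative) (auto intro: has_vector_derivative_at_within)
  have cont0: "continuous_on S \<psi>" for S
    using d1 by (intro continuous_on_vector_derivative) (auto intro: has_vector_derivative_at_within)
  note cont = cont0 cont1 cont2[THEN continuous_on_subset, OF subset_UNIV]
  have contu: "continuous_on {0..} u"
    using up by (intro continuous_on_vector_derivative) auto
  let ?I = "indicator {a<..b} :: real \<Rightarrow> complex"
  have R: "(\<integral>x. ?I x * (of_real (Re (\<psi> x)) * h x) \<partial>half_line)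
     = of_real (Re (\<psi> b)) * p b - of_real (Re (\<psi> a)) * p a
       - (\<integral>x. ?I x * (of_real (Re (\<psi>' x)) * p x) \<partial>half_line)"
    unfolding h_def using d1 d2 cont2
    by (intro green_real[OF u p up _ _ _ ab, where \<psi>''="\<lambda>x. Re (\<psi>'' x)"] continuous_intros)
       (auto simp: has_real_derivative_iff_has_vector_derivative intro: bounded_linear.has_vector_derivative[OF bounded_linear_Re])
  have Im: "(\<integral>x. ?I x * (of_real (Im (\<psi> x)) * h x) \<partial>half_line)
     = of_real (Im (\<psi> b)) * p b - of_real (Im (\<psi> a)) * p a
       - (\<integral>x. ?I x * (of_real (Im (\<psi>' x)) * p x) \<partial>half_line)"
    unfolding h_def using d1 d2 cont2
    by (intro green_real[OF u p up _ _ _ ab, where \<psi>''="\<lambda>x. Im (\<psi>'' x)"] continuous_intros)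
       (auto simp: has_real_derivative_iff_has_vector_derivative intro: bounded_linear.has_vector_derivative[OF bounded_linear_Im])
  \<comment> \<open>Needed for two kinds of \<open>g\<close>: the weak second derivative, known to
    be in \<open>L2\<close>, and \<open>p\<close>, known to be continuous.\<close>
  have split: "(\<integral>x. ?I x * (\<theta> x * g x) \<partial>half_line)
      = (\<integral>x. ?I x * (of_real (Re (\<theta> x)) * g x) \<partial>half_line)
        + \<i> * (\<integral>x. ?I x * (of_real (Im (\<theta> x)) * g x) \<partial>half_line)"
    if \<theta>: "continuous_on {0..} \<theta>" and g: "g \<in> L2 \<or> continuous_on {0..} g" for \<theta> g :: "real \<Rightarrow> complex"
  proof -
    have i: "integrable half_line (\<lambda>x. ?I x * (r x * g x))" if "continuous_on {0..} r" for r
      using g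
    proof
      assume "g \<in> L2"
      then show ?thesis using ab that by (intro integrable_continuous_mult_L2) auto
    next
      assume "continuous_on {0..} g"
      then show ?thesis using ab that by (intro integrable_continuous_indicator continuous_intros) auto
    qed
    have i: "integrable half_line (\<lambda>x. ?I x * (of_real (Re (\<theta> x)) * g x))"
      "integrable half_line (\<lambda>x. ?I x * (of_real (Im (\<theta> x)) * g x))"
      using \<theta> by (auto intro!: i continuous_intros)
    have "?I x * (\<theta> x * g x) = ?I x * (of_real (Re (\<theta> x)) * g x) + \<i> * (?I x * (of_real (Im (\<theta> x)) * g x))" for x
      by (subst (1) complex_eq[of "\<theta> x"]) (simp add: algebra_simps)
    then show ?thesis using i by simp
  qed
  have "(\<integral>x. ?I x * (\<psi>'' x * u x + \<psi>' x * p x) \<partial>half_line) = \<psi>' b * u b - \<psi>' a * u a"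
  proof (rule half_line_FTC)
    show "continuous_on {0..} (\<lambda>x. \<psi>'' x * u x + \<psi>' x * p x)"
      by (intro continuous_intros cont contu p)
    fix x :: real assume "x \<ge> 0"
    show "((\<lambda>x. \<psi>' x * u x) has_vector_derivative \<psi>'' x * u x + \<psi>' x * p x) (at x within {0..})"
      using has_vector_derivative_mult[OF has_vector_derivative_at_within[OF d2] up[OF \<open>x \<ge> 0\<close>]]
      by (simp add: add.commute)
  qed (use ab in auto)
  also have "(\<integral>x. ?I x * (\<psi>'' x * u x + \<psi>' x * p x) \<partial>half_line)
    = (\<integral>x. ?I x * (\<psi>'' x * u x) \<partial>half_line) + (\<integral>x. ?I x * (\<psi>' x * p x) \<partial>half_line)"
    unfolding distrib_left using ab
    by (intro Bochner_Integration.integral_add integrable_continuous_indicator continuous_intros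
        cont contu p) auto
  finally have F: "(\<integral>x. ?I x * (\<psi>' x * p x) \<partial>half_line)
      = \<psi>' b * u b - \<psi>' a * u a - (\<integral>x. ?I x * (\<psi>'' x * u x) \<partial>half_line)"
    by (simp add: algebra_simps)
  have "(\<integral>x. ?I x * (\<psi> x * h x) \<partial>half_line) = \<psi> b * p b - \<psi> a * p a
       - (\<integral>x. ?I x * (\<psi>' x * p x) \<partial>half_line)"
  proof -
    have "(\<integral>x. ?I x * (\<psi> x * h x) \<partial>half_line)
        = (of_real (Re (\<psi> b)) + \<i> * of_real (Im (\<psi> b))) * p b
          - (of_real (Re (\<psi> a)) + \<i> * of_real (Im (\<psi> a))) * p a
          - (\<integral>x. ?I x * (\<psi>' x * p x) \<partial>half_line)"
      unfolding split[OF cont0 disjI1[OF h]] split[OF cont1 disjI2[OF p]] R Im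
      by (simp add: ring_distribs mult.assoc)
    then show ?thesis by (simp only: complex_eq[symmetric])
  qed
  then show ?thesis
    unfolding F h_def by (simp add: algebra_simps)
qed

section \<open>Green's formula on half-lines\<close>

lemma indicator_lower_limit:
  fixes G :: "real \<Rightarrow> complex"
  assumes G: "integrable half_line (\<lambda>x. indicator {0<..b} x * G x)"
    and s: "s \<longlonglongrightarrow> 0" "\<And>m. s m \<ge> 0"
  shows "(\<lambda>m. \<integral>x. indicator {s m<..b} x * G x \<partial>half_line) \<longlonglongrightarrow> (\<integral>x. indicator {0<..b} x * G x \<partial>half_line)"
proof (rule integral_dominated_convergence)
  let ?G = "\<lambda>x. indicator {0<..b} x * G x"
  have eq: "indicator {s m<..b} x * G x = indicator {s m<..b} x * ?G x" for m x
    using s(2)[of m] by (auto split: split_indicator)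
  show "integrable half_line (\<lambda>x. norm (?G x))"
    using G by (rule integrable_norm)
  show "?G \<in> borel_measurable half_line"
    using G by simp
  show "(\<lambda>x. indicator {s m<..b} x * G x) \<in> borel_measurable half_line" for m
    unfolding eq[of m]
    by (intro borel_measurable_times[OF _ borel_measurable_integrable[OF G]] half_line_measurable_indicator) auto
  show "AE x in half_line. (\<lambda>m. indicator {s m<..b} x * G x) \<longlonglongrightarrow> ?G x"
  proof (intro AE_I2)
    fix x :: real assume "x \<in> space half_line"
    then have "x > 0" by simp
    then have "\<forall>\<^sub>F m in sequentially. s m < x"
      using s(1) by (auto dest: order_tendstoD)
    then have "\<forall>\<^sub>F m in sequentially. indicator {s m<..b} x * G x = ?G x"
      by eventually_elim (use \<open>x > 0\<close> in \<open>auto split: split_indicator\<close>)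
    then show "(\<lambda>m. indicator {s m<..b} x * G x) \<longlonglongrightarrow> ?G x"
      by (rule tendsto_eventually)
  qed
  show "AE x in half_line. norm (indicator {s m<..b} x * G x) \<le> norm (?G x)" for m
    unfolding eq[of m] by (intro AE_I2) (auto split: split_indicator)
qed

text \<open>Test functions do not reach the vertex, but the boundary terms are continuous up to 0
  and the integrands are integrable there, so the lower end may tend to 0.\<close>

lemma green:
  fixes \<psi> \<psi>' \<psi>'' :: "real \<Rightarrow> complex" and u p :: "real \<Rightarrow> complex"
  assumes u: "u \<in> H2" and p: "continuous_on {0..} p"
    and up: "\<And>x. x \<ge> 0 \<Longrightarrow> (u has_vector_derivative p x) (at x within {0..})"
    and d1: "\<And>x. (\<psi> has_vector_derivative \<psi>' x) (at x)"
    and d2: "\<And>x. (\<psi>' has_vector_derivative \<psi>'' x) (at x)"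
    and cont2: "continuous_on UNIV \<psi>''"
    and ab: "0 \<le> a" "a \<le> b"
  shows "(\<integral>x. indicator {a<..b} x * (\<psi> x * weak_deriv (weak_deriv u) x) \<partial>half_line)
     = (\<psi> b * p b - \<psi>' b * u b) - (\<psi> a * p a - \<psi>' a * u a)
       + (\<integral>x. indicator {a<..b} x * (\<psi>'' x * u x) \<partial>half_line)"
proof -
  consider "a = b" | "0 < a" "a < b" | "a = 0" "0 < b"
    using ab by linarith
  then show ?thesis
  proof cases
    case 3
    define h where "h = weak_deriv (weak_deriv u)"
    have h: "h \<in> L2" using u by (simp add: h_def H2_second_deriv_L2)
    have cont1: "continuous_on S \<psi>'" for S
      using d2 by (intro continuous_on_vector_derivative) (auto intro: has_vector_derivative_at_within)
    have cont0: "continuous_on S \<psi>" for S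
      using d1 by (intro continuous_on_vector_derivative) (auto intro: has_vector_derivative_at_within)
    note cont = cont0 cont1 cont2[THEN continuous_on_subset, OF subset_UNIV]
    have contu: "continuous_on {0..} u"
      using up by (intro continuous_on_vector_derivative) auto
    \<comment> \<open>The double \<open>Suc\<close> keeps \<open>s 0\<close> strictly below
      \<open>b\<close>, as \<open>green_complex\<close> demands a proper interval.\<close>
    define s where "s m = b * inverse (real (Suc (Suc m)))" for m
    have "s \<longlonglongrightarrow> b * 0"
      unfolding s_def[abs_def] by (intro tendsto_intros LIMSEQ_Suc[OF LIMSEQ_inverse_real_of_nat])
    then have s0: "s \<longlonglongrightarrow> 0" by simp
    have sb: "0 < s m" "s m < b" for m
      using 3(2) by (auto simp: s_def field_simps intro!: add_pos_nonneg)
    have lim: "(\<lambda>m. g (s m)) \<longlonglongrightarrow> g 0" if "continuous_on {0..} g" for g :: "real \<Rightarrow> complex"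
      using continuous_on_tendsto_compose[OF that s0] sb by (auto simp: less_imp_le)
    have "(\<lambda>m. \<integral>x. indicator {s m<..b} x * (\<psi> x * h x) \<partial>half_line)
        \<longlonglongrightarrow> (\<integral>x. indicator {0<..b} x * (\<psi> x * h x) \<partial>half_line)"
      using h sb by (intro indicator_lower_limit s0 integrable_continuous_mult_L2 cont) (auto simp: less_imp_le)
    moreover have "(\<lambda>m. \<integral>x. indicator {s m<..b} x * (\<psi> x * h x) \<partial>half_line)
        \<longlonglongrightarrow> (\<psi> b * p b - \<psi>' b * u b) - (\<psi> 0 * p 0 - \<psi>' 0 * u 0)
            + (\<integral>x. indicator {0<..b} x * (\<psi>'' x * u x) \<partial>half_line)"
    proof -
      have eq: "(\<integral>x. indicator {s m<..b} x * (\<psi> x * h x) \<partial>half_line)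
        = (\<psi> b * p b - \<psi>' b * u b) - (\<psi> (s m) * p (s m) - \<psi>' (s m) * u (s m))
            + (\<integral>x. indicator {s m<..b} x * (\<psi>'' x * u x) \<partial>half_line)" for m
        unfolding h_def by (rule green_complex[OF u p up d1 d2 cont2 sb])
      show ?thesis
        unfolding eq
        using sb by (intro tendsto_add tendsto_diff tendsto_mult tendsto_const lim[OF cont0] lim[OF cont1]
            lim[OF p] lim[OF contu] indicator_lower_limit s0 integrable_continuous_indicator
            continuous_on_mult cont contu) (auto simp: less_imp_le)
    qed
    ultimately show ?thesis
      unfolding \<open>a = 0\<close> h_def by (rule LIMSEQ_unique)
  qed (use green_complex[OF u p up d1 d2 cont2] in auto)
qed

lemma L2_exp:
  assumes "Re \<kappa> < 0"
  shows "(\<lambda>x. exp (\<kappa> * complex_of_real x)) \<in> L2"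
proof -
  define e where "e = - 2 * Re \<kappa>"
  have "e > 0" using assms by (simp add: e_def)
  then have "(\<lambda>x. exp (- e * x)) integrable_on {0..}"
    using has_integral_exp_minus_to_infinity[of e 0] by (auto intro: has_integral_integrable)
  then have "(\<lambda>x. exp (- e * x)) absolutely_integrable_on {0..}"
    by (intro nonnegative_absolutely_integrable_1) auto
  then have "(\<lambda>x. exp (- e * x)) absolutely_integrable_on {0<..}"
    by (rule set_integrable_subset) auto
  then have "integrable half_line (\<lambda>x. exp (- e * x))"
    by (simp add: set_integrable_def integrable_restrict_space)
  moreover have "(cmod (exp (\<kappa> * complex_of_real x)))\<^sup>2 = exp (- e * x)" for x
    by (simp add: e_def power2_eq_square flip: exp_add)
  moreover have "(\<lambda>x. exp (\<kappa> * complex_of_real x)) \<in> borel_measurable half_line"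
    by (intro half_line_measurable_continuous continuous_intros)
  ultimately show ?thesis by (simp add: L2_def)
qed

text \<open>The product of two \<open>L2\<close> functions supplies the majorant; \<open>s k\<close>
  collects truncations and polynomial weights, bounded uniformly in \<open>k\<close>.\<close>

lemma L2_product_dominated_convergence:
  fixes s :: "nat \<Rightarrow> real \<Rightarrow> complex"
  assumes e: "e \<in> L2" and g: "g \<in> L2"
    and m: "\<And>k. s k \<in> borel_measurable half_line" "l \<in> borel_measurable half_line"
    and b: "\<And>k x. x > 0 \<Longrightarrow> cmod (s k x) \<le> B"
    and l: "\<And>x. x > 0 \<Longrightarrow> (\<lambda>k. s k x) \<longlonglongrightarrow> l x"
  shows "(\<lambda>k. \<integral>x. s k x * (e x * g x) \<partial>half_line) \<longlonglongrightarrow> (\<integral>x. l x * (e x * g x) \<partial>half_line)"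
proof (rule integral_dominated_convergence)
  have i: "integrable half_line (\<lambda>x. e x * g x)" by (rule integrable_L2_mult[OF e g])
  then show "integrable half_line (\<lambda>x. B * norm (e x * g x))"
    by (intro integrable_mult_right integrable_norm)
  show "(\<lambda>x. l x * (e x * g x)) \<in> borel_measurable half_line"
    by (rule borel_measurable_times[OF m(2) borel_measurable_integrable[OF i]])
  show "(\<lambda>x. s k x * (e x * g x)) \<in> borel_measurable half_line" for k
    by (rule borel_measurable_times[OF m(1) borel_measurable_integrable[OF i]])
  show "AE x in half_line. (\<lambda>k. s k x * (e x * g x)) \<longlonglongrightarrow> l x * (e x * g x)"
    by (intro AE_I2 tendsto_intros l) simp
  show "AE x in half_line. norm (s k x * (e x * g x)) \<le> B * norm (e x * g x)" for k
    using b by (intro AE_I2) (simp add: norm_mult[of "s k _"] mult_right_mono del: norm_mult)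
qed

text \<open>The weight \<open>(1 - (t - x) / k)\<^sup>2\<close> removes the boundary terms at \<open>x + k\<close>, about
  which nothing is known.\<close>

lemma green_exp_half_line:
  fixes u p :: "real \<Rightarrow> complex"
  assumes u: "u \<in> H2" and p: "continuous_on {0..} p"
    and up: "\<And>x. x \<ge> 0 \<Longrightarrow> (u has_vector_derivative p x) (at x within {0..})"
    and \<kappa>: "Re \<kappa> < 0" and x: "x \<ge> 0"
  shows "(\<integral>t. indicator {x<..} t * (exp (\<kappa> * of_real t) * weak_deriv (weak_deriv u) t) \<partial>half_line)
     = - exp (\<kappa> * of_real x) * (p x - \<kappa> * u x)
       + \<kappa>\<^sup>2 * (\<integral>t. indicator {x<..} t * (exp (\<kappa> * of_real t) * u t) \<partial>half_line)"
proof -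
  define h where "h = weak_deriv (weak_deriv u)"
  define e where "e t = exp (\<kappa> * complex_of_real t)" for t
  have L2s: "h \<in> L2" "u \<in> L2" "e \<in> L2"
    using u L2_exp[OF \<kappa>] by (simp_all add: h_def e_def[abs_def] H2_second_deriv_L2 H2_imp_L2)
  define q where "q k t = 1 - complex_of_real ((t - x) / real (Suc k))" for k t
  let ?i = "\<lambda>k. 1 / complex_of_real (real (Suc k))"
  let ?I = "\<lambda>k. indicator {x<..x + real (Suc k)} :: real \<Rightarrow> complex"
  have q_bound: "cmod (q k t) \<le> 1" if "t \<in> {x<..x + real (Suc k)}" for k t
  proof -
    have "0 \<le> (t - x) / real (Suc k)" "(t - x) / real (Suc k) \<le> 1"
      using that by (auto simp: field_simps)
    then have "\<bar>1 - (t - x) / real (Suc k)\<bar> \<le> 1" by simp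
    moreover have "q k t = complex_of_real (1 - (t - x) / real (Suc k))"
      by (simp add: q_def)
    ultimately show ?thesis by (simp only: norm_of_real)
  qed
  have inv0: "?i \<longlonglongrightarrow> 0"
  proof -
    have "(\<lambda>k. complex_of_real (inverse (real (Suc k)))) \<longlonglongrightarrow> complex_of_real 0"
      by (intro tendsto_of_real LIMSEQ_inverse_real_of_nat)
    then show ?thesis by (simp add: inverse_eq_divide)
  qed
  have q_lim: "(\<lambda>k. q k t) \<longlonglongrightarrow> 1" for t
  proof -
    have "(\<lambda>k. 1 - complex_of_real (t - x) * ?i k) \<longlonglongrightarrow> 1 - complex_of_real (t - x) * 0"
      by (intro tendsto_intros inv0)
    then show ?thesis by (simp add: q_def[abs_def])
  qed
  have I_lim: "(\<lambda>k. ?I k t) \<longlonglongrightarrow> indicator {x<..} t" for t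
  proof -
    obtain N where N: "t - x < real N" using reals_Archimedean2 by blast
    have "\<forall>\<^sub>F k in sequentially. ?I k t = indicator {x<..} t"
      using eventually_ge_at_top[of N]
      by eventually_elim (use N in \<open>auto split: split_indicator\<close>)
    then show ?thesis by (rule tendsto_eventually)
  qed
  have step: "(\<integral>t. ?I k t * (q k t)\<^sup>2 * (e t * h t) \<partial>half_line)
     = - (e x * p x - e x * (\<kappa> - 2 * ?i k) * u x)
       + (\<integral>t. ?I k t * (\<kappa>\<^sup>2 * (q k t)\<^sup>2 - 4 * \<kappa> * ?i k * q k t + 2 * (?i k)\<^sup>2) * (e t * u t) \<partial>half_line)" for k
  proof -
    define i where "i = ?i k"
    have qi: "q k t = 1 - of_real (t - x) * i" for t
      by (simp add: q_def i_def)
    have dq: "(q k has_vector_derivative - i) (at t)" for t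
      unfolding qi[abs_def]
      by (auto intro!: derivative_eq_intros simp: has_vector_derivative_def scaleR_conv_of_real fun_eq_iff algebra_simps)
    have de: "(e has_vector_derivative \<kappa> * e t) (at t)" for t
      unfolding e_def[abs_def]
      by (rule has_vector_derivative_real_field) (auto intro!: derivative_eq_intros)
    have dq2: "((\<lambda>t. (q k t)\<^sup>2) has_vector_derivative - 2 * i * q k t) (at t)" for t
      using has_vector_derivative_mult[OF dq dq, of t] by (simp add: power2_eq_square algebra_simps)
    have d1: "((\<lambda>t. e t * (q k t)\<^sup>2) has_vector_derivative e t * (\<kappa> * (q k t)\<^sup>2 - 2 * i * q k t)) (at t)" for t
      using has_vector_derivative_mult[OF de dq2, of t] by (simp add: algebra_simps)
    have d2: "((\<lambda>t. e t * (\<kappa> * (q k t)\<^sup>2 - 2 * i * q k t)) has_vector_derivative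
        e t * (\<kappa>\<^sup>2 * (q k t)\<^sup>2 - 4 * \<kappa> * i * q k t + 2 * i\<^sup>2)) (at t)" for t
    proof -
      have "((\<lambda>t. \<kappa> * (q k t)\<^sup>2 - 2 * i * q k t) has_vector_derivative
          \<kappa> * (- 2 * i * q k t) - 2 * i * (- i)) (at t)"
        by (intro has_vector_derivative_diff has_vector_derivative_mult_right dq2 dq)
      from has_vector_derivative_mult[OF de this] show ?thesis
        by (simp add: power2_eq_square algebra_simps)
    qed
    have c: "continuous_on UNIV (\<lambda>t. e t * (\<kappa>\<^sup>2 * (q k t)\<^sup>2 - 4 * \<kappa> * i * q k t + 2 * i\<^sup>2))"
      unfolding e_def[abs_def] qi[abs_def] by (intro continuous_intros)
    \<comment> \<open>The reason for the square in the weight: the test function and its derivative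
      both keep a factor \<open>q k\<close>, so at the far end the terms with \<open>p\<close> and
      with \<open>u\<close> vanish together. At \<open>x\<close> the weight is 1, and its slope
      \<open>- 2 * i\<close> disappears in the limit.\<close>
    have "q k x = 1" "q k (x + real (Suc k)) = 0"
      by (simp_all add: q_def)
    then show ?thesis
      using green[OF u p up d1 d2 c x, of "x + real (Suc k)"]
      by (simp add: h_def i_def mult_ac)
  qed
  have meas: "?I k \<in> borel_measurable half_line" "q k \<in> borel_measurable half_line"
    "(indicator {x<..} :: real \<Rightarrow> complex) \<in> borel_measurable half_line" for k
    unfolding q_def[abs_def]
    by (intro half_line_measurable_indicator half_line_measurable_continuous continuous_intros; simp)+
  have ci: "cmod (?i k) \<le> 1" for k
    by (simp add: norm_divide field_simps del: of_nat_Suc)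
  have l1: "(\<lambda>k. \<integral>t. ?I k t * (q k t)\<^sup>2 * (e t * h t) \<partial>half_line)
      \<longlonglongrightarrow> (\<integral>t. indicator {x<..} t * 1\<^sup>2 * (e t * h t) \<partial>half_line)"
  proof (rule L2_product_dominated_convergence[where B=1])
    show "cmod (?I k t * (q k t)\<^sup>2) \<le> 1" for k t
      using q_bound[of t k] by (auto simp: norm_mult norm_power power_le_one split: split_indicator)
    show "(\<lambda>t. ?I k t * (q k t)\<^sup>2) \<in> borel_measurable half_line" for k
      by (intro borel_measurable_times borel_measurable_power meas)
    show "(\<lambda>t. indicator {x<..} t * 1\<^sup>2 :: complex) \<in> borel_measurable half_line"
      by (intro borel_measurable_times meas borel_measurable_const)
    show "(\<lambda>k. ?I k t * (q k t)\<^sup>2) \<longlonglongrightarrow> indicator {x<..} t * 1\<^sup>2" for t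
      by (intro tendsto_intros q_lim I_lim)
  qed (use L2s in auto)
  have l2: "(\<lambda>k. \<integral>t. ?I k t * (\<kappa>\<^sup>2 * (q k t)\<^sup>2 - 4 * \<kappa> * ?i k * q k t + 2 * (?i k)\<^sup>2) * (e t * u t) \<partial>half_line)
      \<longlonglongrightarrow> (\<integral>t. indicator {x<..} t * (\<kappa>\<^sup>2 * 1\<^sup>2 - 4 * \<kappa> * 0 * 1 + 2 * 0\<^sup>2) * (e t * u t) \<partial>half_line)"
  proof (rule L2_product_dominated_convergence[where B="(cmod \<kappa>)\<^sup>2 + 4 * cmod \<kappa> + 2"])
    show "cmod (?I k t * (\<kappa>\<^sup>2 * (q k t)\<^sup>2 - 4 * \<kappa> * ?i k * q k t + 2 * (?i k)\<^sup>2)) \<le> (cmod \<kappa>)\<^sup>2 + 4 * cmod \<kappa> + 2"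
      for k t
    proof (cases "t \<in> {x<..x + real (Suc k)}")
      case True
      have "cmod (\<kappa>\<^sup>2 * (q k t)\<^sup>2 - 4 * \<kappa> * ?i k * q k t + 2 * (?i k)\<^sup>2)
          \<le> cmod (\<kappa>\<^sup>2 * (q k t)\<^sup>2) + cmod (4 * \<kappa> * ?i k * q k t) + cmod (2 * (?i k)\<^sup>2)"
        by (intro order.trans[OF norm_triangle_ineq] add_right_mono norm_triangle_ineq4)
      also have "\<dots> = (cmod \<kappa>)\<^sup>2 * (cmod (q k t))\<^sup>2 + 4 * cmod \<kappa> * (cmod (?i k) * cmod (q k t)) + 2 * (cmod (?i k))\<^sup>2"
        by (simp only: norm_mult norm_power) simp
      also have "\<dots> \<le> (cmod \<kappa>)\<^sup>2 * 1 + 4 * cmod \<kappa> * 1 + 2 * 1"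
        using q_bound[OF True] ci[of k]
        by (intro add_mono mult_left_mono power_le_one mult_le_one) auto
      finally show ?thesis using True by simp
    next
      case False
      then show ?thesis by simp
    qed
    show "(\<lambda>t. indicator {x<..} t * (\<kappa>\<^sup>2 * 1\<^sup>2 - 4 * \<kappa> * 0 * 1 + 2 * 0\<^sup>2)) \<in> borel_measurable half_line"
      by (intro borel_measurable_times meas borel_measurable_const)
    show "(\<lambda>t. ?I k t * (\<kappa>\<^sup>2 * (q k t)\<^sup>2 - 4 * \<kappa> * ?i k * q k t + 2 * (?i k)\<^sup>2)) \<in> borel_measurable half_line" for k
      by (intro borel_measurable_times borel_measurable_add borel_measurable_diff borel_measurable_power
          meas borel_measurable_const)
    show "(\<lambda>k. ?I k t * (\<kappa>\<^sup>2 * (q k t)\<^sup>2 - 4 * \<kappa> * ?i k * q k t + 2 * (?i k)\<^sup>2))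
        \<longlonglongrightarrow> indicator {x<..} t * (\<kappa>\<^sup>2 * 1\<^sup>2 - 4 * \<kappa> * 0 * 1 + 2 * 0\<^sup>2)" for t
      by (intro tendsto_intros q_lim I_lim inv0)
  qed (use L2s in auto)
  have "(\<lambda>k. - (e x * p x - e x * (\<kappa> - 2 * ?i k) * u x)
       + (\<integral>t. ?I k t * (\<kappa>\<^sup>2 * (q k t)\<^sup>2 - 4 * \<kappa> * ?i k * q k t + 2 * (?i k)\<^sup>2) * (e t * u t) \<partial>half_line))
     \<longlonglongrightarrow> - (e x * p x - e x * (\<kappa> - 2 * 0) * u x)
       + (\<integral>t. indicator {x<..} t * (\<kappa>\<^sup>2 * 1\<^sup>2 - 4 * \<kappa> * 0 * 1 + 2 * 0\<^sup>2) * (e t * u t) \<partial>half_line)"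
    by (intro tendsto_intros inv0 l2)
  from LIMSEQ_unique[OF l1[unfolded step] this]
  have "(\<integral>t. indicator {x<..} t * (e t * h t) \<partial>half_line) = - (e x * p x - e x * \<kappa> * u x)
      + (\<integral>t. \<kappa>\<^sup>2 * (indicator {x<..} t * (e t * u t)) \<partial>half_line)"
    by (simp add: mult_ac)
  then show ?thesis
    unfolding integral_mult_right_zero h_def e_def by (simp add: algebra_simps)
qed

section \<open>The equation on a single branch\<close>

text \<open>The multiplier \<open>C * \<psi>'' + d * \<psi>\<close> of \<open>u\<close> is kept
  because it serves two purposes: it vanishes when \<open>\<psi>\<close> solves the homogeneous
  equation, and in the resonance argument it is small.\<close>

lemma branch_interval:
  fixes \<psi> \<psi>' :: "real \<Rightarrow> complex" and u p f :: "real \<Rightarrow> complex"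
  assumes u: "u \<in> H2" and p: "continuous_on {0..} p"
    and up: "\<forall>x\<ge>0. (u has_vector_derivative p x) (at x within {0..})"
    and f: "AE x in half_line. f x = C * weak_deriv (weak_deriv u) x + d * u x"
      "f \<in> borel_measurable half_line"
    and d1: "\<And>x. (\<psi> has_vector_derivative \<psi>' x) (at x)"
    and d2: "\<And>x. (\<psi>' has_vector_derivative \<psi>'' x) (at x)"
    and cont2: "continuous_on UNIV \<psi>''"
    and ab: "0 \<le> a" "a \<le> b"
  shows "integrable half_line (\<lambda>x. indicator {a<..b} x * (\<psi> x * f x))"
    and "(\<integral>x. indicator {a<..b} x * (\<psi> x * f x) \<partial>half_line)
     = C * ((\<psi> b * p b - \<psi>' b * u b) - (\<psi> a * p a - \<psi>' a * u a))
       + (\<integral>x. indicator {a<..b} x * ((C * \<psi>'' x + d * \<psi> x) * u x) \<partial>half_line)"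
proof -
  define h where "h = weak_deriv (weak_deriv u)"
  have L2s: "h \<in> L2" "u \<in> L2" using u by (simp_all add: h_def H2_second_deriv_L2 H2_imp_L2)
  have cont0: "continuous_on S \<psi>" for S
    using d1 by (intro continuous_on_vector_derivative) (auto intro: has_vector_derivative_at_within)
  note cont2' = cont2[THEN continuous_on_subset, OF subset_UNIV]
  let ?I = "indicator {a<..b} :: real \<Rightarrow> complex"
  have ih: "integrable half_line (\<lambda>x. ?I x * (\<psi> x * h x))"
    and iu: "integrable half_line (\<lambda>x. ?I x * (\<psi> x * u x))"
    and iu2: "integrable half_line (\<lambda>x. ?I x * (\<psi>'' x * u x))"
    using ab L2s by (intro integrable_continuous_mult_L2 cont0 cont2'; simp)+
  have ae: "AE x in half_line. ?I x * (\<psi> x * f x) = C * (?I x * (\<psi> x * h x)) + d * (?I x * (\<psi> x * u x))"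
    using f(1) by eventually_elim (simp add: h_def algebra_simps)
  have m: "(\<lambda>x. ?I x * (\<psi> x * f x)) \<in> borel_measurable half_line"
    by (rule borel_measurable_times[OF half_line_measurable_indicator
          borel_measurable_times[OF half_line_measurable_continuous[OF cont0] f(2)]]) simp
  have i: "integrable half_line (\<lambda>x. C * (?I x * (\<psi> x * h x)) + d * (?I x * (\<psi> x * u x)))"
    using ih iu by simp
  show "integrable half_line (\<lambda>x. ?I x * (\<psi> x * f x))"
    using integrable_cong_AE[OF m borel_measurable_integrable[OF i] ae] i by blast
  have "(\<integral>x. ?I x * (\<psi> x * f x) \<partial>half_line)
      = (\<integral>x. C * (?I x * (\<psi> x * h x)) + d * (?I x * (\<psi> x * u x)) \<partial>half_line)"
    by (rule integral_cong_AE[OF m borel_measurable_integrable[OF i] ae])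
  also have "\<dots> = C * (\<integral>x. ?I x * (\<psi> x * h x) \<partial>half_line) + d * (\<integral>x. ?I x * (\<psi> x * u x) \<partial>half_line)"
    using ih iu by simp
  also have "\<dots> = C * ((\<psi> b * p b - \<psi>' b * u b) - (\<psi> a * p a - \<psi>' a * u a))
      + (C * (\<integral>x. ?I x * (\<psi>'' x * u x) \<partial>half_line) + d * (\<integral>x. ?I x * (\<psi> x * u x) \<partial>half_line))"
  proof -
    have "(\<integral>x. ?I x * (\<psi> x * h x) \<partial>half_line)
        = (\<psi> b * p b - \<psi>' b * u b) - (\<psi> a * p a - \<psi>' a * u a) + (\<integral>x. ?I x * (\<psi>'' x * u x) \<partial>half_line)"
      unfolding h_def by (rule green[OF u p up[rule_format] d1 d2 cont2 ab])
    then show ?thesis by (simp only: distrib_left add.assoc)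
  qed
  also have "C * (\<integral>x. ?I x * (\<psi>'' x * u x) \<partial>half_line) + d * (\<integral>x. ?I x * (\<psi> x * u x) \<partial>half_line)
      = (\<integral>x. C * (?I x * (\<psi>'' x * u x)) + d * (?I x * (\<psi> x * u x)) \<partial>half_line)"
    using iu iu2 by simp
  also have "\<dots> = (\<integral>x. ?I x * ((C * \<psi>'' x + d * \<psi> x) * u x) \<partial>half_line)"
    by (intro Bochner_Integration.integral_cong refl) (simp add: algebra_simps)
  finally show "(\<integral>x. ?I x * (\<psi> x * f x) \<partial>half_line)
     = C * ((\<psi> b * p b - \<psi>' b * u b) - (\<psi> a * p a - \<psi>' a * u a))
       + (\<integral>x. ?I x * ((C * \<psi>'' x + d * \<psi> x) * u x) \<partial>half_line)" .
qed

text \<open>\<open>\<kappa>\<close> is a decaying root of the characteristic equation, so the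
  integrals of \<open>u\<close> cancel and only the boundary term at \<open>x\<close>
  survives.\<close>

lemma branch_half_line:
  fixes u p f :: "real \<Rightarrow> complex"
  assumes u: "u \<in> H2" and p: "continuous_on {0..} p"
    and up: "\<forall>x\<ge>0. (u has_vector_derivative p x) (at x within {0..})"
    and f: "AE x in half_line. f x = C * weak_deriv (weak_deriv u) x + d * u x"
      "f \<in> borel_measurable half_line"
    and \<kappa>: "Re \<kappa> < 0" "C * \<kappa>\<^sup>2 + d = 0" and x: "x \<ge> 0"
  shows "integrable half_line (\<lambda>t. indicator {x<..} t * (exp (\<kappa> * of_real t) * f t))"
    and "(\<integral>t. indicator {x<..} t * (exp (\<kappa> * of_real t) * f t) \<partial>half_line)
     = - C * exp (\<kappa> * of_real x) * (p x - \<kappa> * u x)"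
proof -
  define h where "h = weak_deriv (weak_deriv u)"
  define e where "e t = exp (\<kappa> * complex_of_real t)" for t
  have L2s: "h \<in> L2" "u \<in> L2" "e \<in> L2"
    using u L2_exp[OF \<kappa>(1)] by (simp_all add: h_def e_def[abs_def] H2_second_deriv_L2 H2_imp_L2)
  let ?I = "indicator {x<..} :: real \<Rightarrow> complex"
  have mI: "?I \<in> borel_measurable half_line" by (rule half_line_measurable_indicator) simp
  have i: "integrable half_line (\<lambda>t. ?I t * (e t * g t))" if "g \<in> L2" for g
    using integrable_L2_mult[OF L2_mult_bounded[OF L2s(3) mI, of 1] that]
    by (auto simp: mult.assoc split: split_indicator)
  have ae: "AE t in half_line. ?I t * (e t * f t) = C * (?I t * (e t * h t)) + d * (?I t * (e t * u t))"
    using f(1) by eventually_elim (simp add: h_def algebra_simps)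
  have m: "(\<lambda>t. ?I t * (e t * f t)) \<in> borel_measurable half_line"
    using f(2) L2_measurable[OF L2s(3)] mI by (intro borel_measurable_times)
  have i2: "integrable half_line (\<lambda>t. C * (?I t * (e t * h t)) + d * (?I t * (e t * u t)))"
    using i[OF L2s(1)] i[OF L2s(2)] by simp
  show "integrable half_line (\<lambda>t. ?I t * (exp (\<kappa> * of_real t) * f t))"
    using integrable_cong_AE[OF m borel_measurable_integrable[OF i2] ae] i2 by (simp add: e_def)
  have "(\<integral>t. ?I t * (e t * f t) \<partial>half_line)
      = (\<integral>t. C * (?I t * (e t * h t)) + d * (?I t * (e t * u t)) \<partial>half_line)"
    by (rule integral_cong_AE[OF m borel_measurable_integrable[OF i2] ae])
  also have "\<dots> = C * (\<integral>t. ?I t * (e t * h t) \<partial>half_line) + d * (\<integral>t. ?I t * (e t * u t) \<partial>half_line)"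
    using i[OF L2s(1)] i[OF L2s(2)] by simp
  also have "(\<integral>t. ?I t * (e t * h t) \<partial>half_line) = - e x * (p x - \<kappa> * u x)
      + \<kappa>\<^sup>2 * (\<integral>t. ?I t * (e t * u t) \<partial>half_line)"
    using green_exp_half_line[OF u p up[rule_format] \<kappa>(1) x] by (simp add: e_def h_def)
  also have "C * (- e x * (p x - \<kappa> * u x) + \<kappa>\<^sup>2 * (\<integral>t. ?I t * (e t * u t) \<partial>half_line))
      + d * (\<integral>t. ?I t * (e t * u t) \<partial>half_line)
      = - C * e x * (p x - \<kappa> * u x) + (C * \<kappa>\<^sup>2 + d) * (\<integral>t. ?I t * (e t * u t) \<partial>half_line)"
    by (simp add: algebra_simps)
  finally show "(\<integral>t. ?I t * (exp (\<kappa> * of_real t) * f t) \<partial>half_line)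
     = - C * exp (\<kappa> * of_real x) * (p x - \<kappa> * u x)"
    using \<kappa>(2) by (simp add: e_def)
qed

section \<open>Square roots and characteristic exponents for nonreal parameters\<close>

text \<open>Off the real axis \<open>lower_arg\<close> agrees with \<open>Arg\<close>, and halving
  an argument strictly between \<open>- pi\<close> and \<open>pi\<close> keeps the sign of its
  sine.\<close>

lemma lower_sqrt_nonreal:
  assumes "Im \<zeta> \<noteq> 0"
  shows "(lower_sqrt \<zeta>)\<^sup>2 = \<zeta>" and "0 < Im \<zeta> * Im (lower_sqrt \<zeta>)"
proof -
  have nz: "\<zeta> \<noteq> 0" and npi: "Arg \<zeta> \<noteq> pi"
    using assms by (auto simp: Arg_eq_pi)
  then have la: "lower_arg \<zeta> = Arg \<zeta>" by (simp add: lower_arg_def)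
  have "(exp (\<i> * complex_of_real (Arg \<zeta> / 2)))\<^sup>2 = exp (\<i> * complex_of_real (Arg \<zeta>))"
    by (simp flip: exp_double)
  moreover have "(complex_of_real (sqrt (cmod \<zeta>)))\<^sup>2 = complex_of_real (cmod \<zeta>)"
    by (simp flip: of_real_power)
  ultimately have "(lower_sqrt \<zeta>)\<^sup>2 = complex_of_real (cmod \<zeta>) * exp (\<i> * complex_of_real (Arg \<zeta>))"
    by (simp only: lower_sqrt_def la power_mult_distrib)
  also have "\<dots> = \<zeta>"
    using Arg_eq[OF nz] by simp
  finally show "(lower_sqrt \<zeta>)\<^sup>2 = \<zeta>" .
  have im: "Im (lower_sqrt \<zeta>) = sqrt (cmod \<zeta>) * sin (Arg \<zeta> / 2)"
    by (simp add: lower_sqrt_def la Im_exp)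
  have s: "sqrt (cmod \<zeta>) > 0" using nz by simp
  show "0 < Im \<zeta> * Im (lower_sqrt \<zeta>)"
  proof (cases "Im \<zeta> > 0")
    case True
    then have "0 < Arg \<zeta> \<and> Arg \<zeta> < pi" by (simp add: Arg_lt_pi)
    then have "sin (Arg \<zeta> / 2) > 0" by (intro sin_gt_zero) auto
    with True s show ?thesis by (simp add: im)
  next
    case False
    then have "Im \<zeta> < 0" using assms by simp
    moreover from this have "Arg \<zeta> < 0" using Arg_less_0[of \<zeta>] by (auto simp: not_le)
    then have "0 < sin (- (Arg \<zeta> / 2))"
      using Arg_bounded[of \<zeta>] by (intro sin_gt_zero) linarith+
    then have "sin (Arg \<zeta> / 2) < 0" by simp
    ultimately show ?thesis using s by (simp add: im mult_neg_neg mult_pos_neg)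
  qed
qed

lemma pm_square: "pm z * pm z = 1"
  by (simp add: pm_def)

text \<open>Neither the real shift by \<open>a k\<close> nor division by \<open>c k > 0\<close>
  changes the sign of the imaginary part, so \<open>xi\<close> lies in the same half-plane as
  \<open>z\<close>. The factor \<open>pm z * \<i>\<close> rotates it into the left half-plane in
  both cases; this is what the sign convention is made for.\<close>

lemma xi_nonreal:
  fixes a c :: "nat \<Rightarrow> real"
  assumes "Im z \<noteq> 0" "c k > 0"
  defines "\<kappa> \<equiv> pm z * \<i> * xi c a z k"
  shows "Re \<kappa> < 0" and "of_real (c k) * \<kappa>\<^sup>2 + (z - of_real (a k)) = 0"
    and "of_real (c k) * (xi c a z k)\<^sup>2 = z - of_real (a k)" and "xi c a z k \<noteq> 0"
proof -
  define \<zeta> where "\<zeta> = (z - complex_of_real (a k)) / complex_of_real (c k)"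
  have im: "Im \<zeta> = Im z / c k" by (simp add: \<zeta>_def Im_divide_of_real)
  then have nr: "Im \<zeta> \<noteq> 0" using assms by simp
  have xi: "xi c a z k = lower_sqrt \<zeta>" by (simp add: xi_def \<zeta>_def)
  show sq: "of_real (c k) * (xi c a z k)\<^sup>2 = z - of_real (a k)"
    using lower_sqrt_nonreal(1)[OF nr] assms(2) by (simp add: xi \<zeta>_def)
  have "\<kappa>\<^sup>2 = - (xi c a z k)\<^sup>2"
    using pm_square[of z] by (simp add: \<kappa>_def power2_eq_square algebra_simps)
  then show "of_real (c k) * \<kappa>\<^sup>2 + (z - of_real (a k)) = 0"
    using sq by simp
  show "xi c a z k \<noteq> 0" using lower_sqrt_nonreal(2)[OF nr] by (auto simp: xi)
  have "0 < Im z / c k * Im (xi c a z k)"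
    using lower_sqrt_nonreal(2)[OF nr] by (simp add: im xi)
  then have "0 < Im z * Im (xi c a z k)"
    using assms(2) by (simp add: zero_less_mult_iff zero_less_divide_iff divide_less_0_iff)
  then show "Re \<kappa> < 0"
    by (auto simp: \<kappa>_def pm_def zero_less_mult_iff)
qed

lemma exp_pm: "exp (pm z * \<i> * t) = cos t + pm z * \<i> * sin t"
  using exp_Euler[of t] exp_Euler[of "- t"] by (auto simp: pm_def)

lemma next_branch_neq: "n \<ge> 2 \<Longrightarrow> next_branch n j \<noteq> j"
  by (auto simp: next_branch_def)

lemma dom_A_branch:
  assumes "u \<in> dom_A n c" "k \<in> {1..n}"
  shows "u k \<in> H2"
    and "\<exists>p. continuous_on {0..} p \<and> (\<forall>x\<ge>0. (u k has_vector_derivative p x) (at x within {0..}))"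
  using assms by (auto simp: dom_A_def T1_def C1_closed_half_line_def)

lemma shifted_A_branch:
  assumes "H_eq n (shifted_A c a z u) f" "k \<in> {1..n}"
  shows "AE x in half_line. f k x
    = of_real (c k) * weak_deriv (weak_deriv (u k)) x + (z - of_real (a k)) * u k x"
proof -
  have "AE x in half_line. shifted_A c a z u k x = f k x"
    using assms by (simp add: H_eq_def)
  then show ?thesis
    by eventually_elim (auto simp: shifted_A_def op_A_def scaleR_conv_of_real algebra_simps)
qed

section \<open>Real parameters are excluded by resonance\<close>

text \<open>The amplitude \<open>1 / t\<close> is square-integrable, yet its integral against a
  fixed weight profile stretched to length \<open>B\<close> does not shrink as \<open>B\<close>
  grows. The maximum with 1 removes the singularity at 0.\<close>

lemma L2_slow_decay:
  "(\<lambda>t. exp (- \<i> * of_real (\<mu> * t)) / of_real (max 1 t)) \<in> L2"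
proof -
  let ?f = "\<lambda>t. exp (- \<i> * complex_of_real (\<mu> * t)) / complex_of_real (max 1 t)"
  have m: "?f \<in> borel_measurable half_line"
    by (intro half_line_measurable_continuous continuous_intros) (auto simp: max_def)
  have n: "(cmod (?f t))\<^sup>2 = 1 / (max 1 t)\<^sup>2" for t
    by (simp add: norm_divide power_divide)
  have "(\<lambda>t::real. 1 / t ^ 2) integrable_on {1..}"
    using has_integral_inverse_power_to_inf[of 2 1] by (auto intro: has_integral_integrable)
  then have "(\<lambda>t::real. 1 / t ^ 2) absolutely_integrable_on {1..}"
    by (intro nonnegative_absolutely_integrable_1) auto
  then have "integrable lebesgue (\<lambda>t::real. indicator {1..} t *\<^sub>R (1 / t ^ 2))"
    by (simp add: set_integrable_def)
  moreover have "(\<lambda>t::real. indicator {0<..} t *\<^sub>R (indicator {1..} t *\<^sub>R (1 / t ^ 2)))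
      = (\<lambda>t. indicator {1..} t *\<^sub>R (1 / t ^ 2))"
    by (auto split: split_indicator)
  ultimately have i: "integrable half_line (\<lambda>t::real. indicator {1..} t *\<^sub>R (1 / t ^ 2))"
    by (subst integrable_restrict_space) auto
  have "integrable half_line (\<lambda>t. (cmod (?f t))\<^sup>2)"
  proof (rule Bochner_Integration.integrable_bound)
    show "integrable half_line (\<lambda>t. indicator {0<..1} t + indicator {1..} t *\<^sub>R (1 / t ^ 2) :: real)"
      by (intro Bochner_Integration.integrable_add half_line_integrable_indicator i)
    show "(\<lambda>t. (cmod (?f t))\<^sup>2) \<in> borel_measurable half_line"
      using m by measurable
    show "AE t in half_line. norm ((cmod (?f t))\<^sup>2)
        \<le> norm (indicator {0<..1} t + indicator {1..} t *\<^sub>R (1 / t ^ 2) :: real)"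
      unfolding n by (intro AE_I2) (auto simp: max_def split: split_indicator)
  qed
  with m show ?thesis by (simp add: L2_def)
qed

text \<open>On a real \<open>z \<ge> a 1\<close> the first branch carries the bounded oscillation \<open>exp (\<i> \<mu> t)\<close>.  Testing a
  solution for the resonant right-hand side against this oscillation with a weight
  \<open>s\<^sup>2 (1 - s)\<^sup>2\<close>, \<open>s = t / T\<^sup>2\<close>, gives a left-hand side bounded below and a right-hand
  side of order \<open>1 / T\<close>.\<close>

lemma resonance:
  fixes u p :: "real \<Rightarrow> complex"
  assumes u: "u \<in> H2" and p: "continuous_on {0..} p"
    and up: "\<forall>x\<ge>0. (u has_vector_derivative p x) (at x within {0..})"
    and \<mu>: "\<mu> \<ge> 0" and C: "C > 0"
    and f: "AE x in half_line. exp (- \<i> * of_real (\<mu> * x)) / of_real (max 1 x)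
       = of_real C * weak_deriv (weak_deriv u) x + of_real (C * \<mu>\<^sup>2) * u x"
  shows False
proof -
  \<comment> \<open>Here 26 = 2 + 12 + 12 and 12 = 2 + 6 + 4 bound the polynomials in
    \<open>Q''\<close> and \<open>Q'\<close> term by term on \<open>[0, 1]\<close>; the latter is
    doubled to 24 by the product rule.\<close>
  define M where "M = C * (26 + 24 * \<mu>)"
  have M: "M > 0" using C \<mu> by (simp add: M_def add_pos_nonneg)
  define U where "U = (\<integral>x. (cmod (u x))\<^sup>2 \<partial>half_line)"
  have U: "U \<ge> 0" by (simp add: U_def)
  \<comment> \<open>The final upper bound will be \<open>M / 2 * (U + 1) / T\<close>; this choice
    pushes it below 1 / 30.\<close>
  obtain N :: nat where N: "30 * (M / 2 * (U + 1)) < real N" using reals_Archimedean2 by blast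
  define T where "T = max 1 (real N)"
  have T: "T \<ge> 1" "30 * (M / 2 * (U + 1)) < T" using N by (auto simp: T_def)
  define B where "B = T\<^sup>2"
  have B: "B \<ge> 1" using T by (simp add: B_def)
  define E where "E t = exp (\<i> * of_real (\<mu> * t))" for t
  \<comment> \<open>Double zeros at 0 and at \<open>B\<close> remove all boundary terms, whatever
    \<open>u\<close> and \<open>p\<close> are there.\<close>
  define Q where "Q t = (t / B)\<^sup>2 * (1 - t / B)\<^sup>2" for t :: real
  define Q' where "Q' t = (2 * (t / B) - 6 * (t / B)^2 + 4 * (t / B)^3) / B" for t :: real
  define Q'' where "Q'' t = (2 - 12 * (t / B) + 12 * (t / B)^2) / B\<^sup>2" for t :: real
  have dE: "(E has_vector_derivative \<i> * \<mu> * E t) (at t)" for t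
    unfolding E_def[abs_def] of_real_mult
    by (rule has_vector_derivative_real_field) (auto intro!: derivative_eq_intros)
  have dQ: "((\<lambda>t. complex_of_real (Q t)) has_vector_derivative of_real (Q' t)) (at t)" for t
  proof (rule has_vector_derivative_of_real)
    show "(Q has_real_derivative Q' t) (at t)"
      using B unfolding Q_def[abs_def] Q'_def
      by (auto intro!: derivative_eq_intros simp: field_simps power2_eq_square power3_eq_cube)
  qed
  have dQ': "((\<lambda>t. complex_of_real (Q' t)) has_vector_derivative of_real (Q'' t)) (at t)" for t
  proof (rule has_vector_derivative_of_real)
    show "(Q' has_real_derivative Q'' t) (at t)"
      using B unfolding Q'_def[abs_def] Q''_def
      by (auto intro!: derivative_eq_intros simp: field_simps power2_eq_square power3_eq_cube)
  qed
  define \<psi> where "\<psi> t = E t * of_real (Q t)" for t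
  define \<psi>' where "\<psi>' t = E t * of_real (Q' t) + \<i> * \<mu> * E t * of_real (Q t)" for t
  define \<psi>'' where "\<psi>'' t = E t * of_real (Q'' t) + 2 * \<i> * \<mu> * E t * of_real (Q' t) - \<mu>\<^sup>2 * E t * of_real (Q t)" for t
  have d1: "(\<psi> has_vector_derivative \<psi>' t) (at t)" for t
    unfolding \<psi>_def[abs_def] \<psi>'_def by (rule has_vector_derivative_mult[OF dE dQ])
  have d2: "(\<psi>' has_vector_derivative \<psi>'' t) (at t)" for t
  proof -
    have "((\<lambda>t. E t * of_real (Q' t) + \<i> * \<mu> * (E t * of_real (Q t))) has_vector_derivative
        (E t * of_real (Q'' t) + \<i> * \<mu> * E t * of_real (Q' t)) + \<i> * \<mu> * \<psi>' t) (at t)"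
      using d1[of t] unfolding \<psi>_def
      by (intro has_vector_derivative_add has_vector_derivative_mult_right has_vector_derivative_mult[OF dE dQ'])
    then show ?thesis
      by (simp add: \<psi>'_def[abs_def] \<psi>''_def algebra_simps power2_eq_square)
  qed
  have cont2: "continuous_on UNIV \<psi>''"
    using B unfolding \<psi>''_def[abs_def] E_def Q_def Q'_def Q''_def by (intro continuous_intros) auto
  have z: "\<psi> 0 = 0" "\<psi>' 0 = 0" "\<psi> B = 0" "\<psi>' B = 0"
    using B by (simp_all add: \<psi>_def \<psi>'_def Q_def Q'_def)
  let ?f = "\<lambda>t. exp (- \<i> * complex_of_real (\<mu> * t)) / complex_of_real (max 1 t)"
  let ?I = "indicator {0<..B} :: real \<Rightarrow> complex"
  have L: "(\<integral>t. ?I t * (\<psi> t * ?f t) \<partial>half_line)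
      = (\<integral>t. ?I t * ((C * \<psi>'' t + of_real (C * \<mu>\<^sup>2) * \<psi> t) * u t) \<partial>half_line)"
    using branch_interval(2)[OF u p up f L2_measurable[OF L2_slow_decay] d1 d2 cont2, of 0 B] B z by simp
  \<comment> \<open>The oscillations cancel, leaving the positive integrand
    \<open>Q t / max 1 t\<close>. On the interval \<open>max 1 t \<le> B\<close>, and 1/30 = 1/3 -
    1/2 + 1/5 is the integral of \<open>s^2 * (1 - s)^2\<close> over \<open>[0, 1]\<close>.\<close>
  have "1 / 30 \<le> cmod (\<integral>t. ?I t * (\<psi> t * ?f t) \<partial>half_line)"
  proof -
    have "?I t * (\<psi> t * ?f t) = complex_of_real (indicator {0<..B} t * (Q t / max 1 t))" for t
      by (simp add: \<psi>_def E_def exp_minus field_simps of_real_indicator)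
    then have e: "(\<integral>t. ?I t * (\<psi> t * ?f t) \<partial>half_line)
        = complex_of_real (\<integral>t. indicator {0<..B} t * (Q t / max 1 t) \<partial>half_line)"
      by (simp only: integral_complex_of_real)
    have re: "complex_of_real (\<integral>t. indicator {0<..B} t * g t \<partial>half_line)
        = (\<integral>t. ?I t * complex_of_real (g t) \<partial>half_line)" for g :: "real \<Rightarrow> real"
      by (simp add: of_real_indicator flip: integral_complex_of_real)
    have ri: "integrable half_line (\<lambda>t. indicator {0<..B} t * g t)" if "continuous_on {0..} g" for g :: "real \<Rightarrow> real"
    proof -
      have "integrable half_line (\<lambda>t. Re (?I t * complex_of_real (g t)))"
        using that by (intro integrable_Re integrable_continuous_indicator continuous_intros) auto
      moreover have "Re (?I t * complex_of_real (g t)) = indicator {0<..B} t * g t" for t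
        by (auto split: split_indicator)
      ultimately show ?thesis by (simp only:)
    qed
    have cQ: "continuous_on S Q" for S
      using B unfolding Q_def[abs_def] by (intro continuous_intros) auto
    have "complex_of_real (\<integral>t. indicator {0<..B} t * (Q t / B) \<partial>half_line) = of_real (1 / 30)"
    proof -
      have "(\<integral>t. ?I t * complex_of_real (Q t / B) \<partial>half_line)
          = complex_of_real ((B / B) ^ 3 / 3 - (B / B) ^ 4 / 2 + (B / B) ^ 5 / 5)
            - complex_of_real ((0 / B) ^ 3 / 3 - (0 / B) ^ 4 / 2 + (0 / B) ^ 5 / 5)"
      proof (rule half_line_FTC)
        show "continuous_on {0..} (\<lambda>t. complex_of_real (Q t / B))"
          using B by (intro continuous_intros cQ) auto
        fix t :: real
        have "((\<lambda>t. (t / B) ^ 3 / 3 - (t / B) ^ 4 / 2 + (t / B) ^ 5 / 5) has_real_derivative Q t / B) (at t)"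
          using B unfolding Q_def
          by (auto intro!: derivative_eq_intros simp: field_simps eval_nat_numeral)
        then show "((\<lambda>t. complex_of_real ((t / B) ^ 3 / 3 - (t / B) ^ 4 / 2 + (t / B) ^ 5 / 5))
            has_vector_derivative complex_of_real (Q t / B)) (at t within {0..})"
          by (intro has_vector_derivative_of_real) (rule has_field_derivative_at_within)
      qed (use B in auto)
      then show ?thesis unfolding re using B by simp
    qed
    then have "1 / 30 = (\<integral>t. indicator {0<..B} t * (Q t / B) \<partial>half_line)"
      unfolding of_real_eq_iff by simp
    also have "\<dots> \<le> (\<integral>t. indicator {0<..B} t * (Q t / max 1 t) \<partial>half_line)"
    proof (rule integral_mono)
      show "integrable half_line (\<lambda>t. indicator {0<..B} t * (Q t / B))"
        "integrable half_line (\<lambda>t. indicator {0<..B} t * (Q t / max 1 t))"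
        using B by (intro ri continuous_intros cQ; auto simp: max_def)+
      fix t
      show "indicator {0<..B} t * (Q t / B) \<le> indicator {0<..B} t * (Q t / max 1 t)"
        using B by (auto simp: Q_def split: split_indicator intro!: divide_left_mono mult_pos_pos)
    qed
    finally show ?thesis unfolding e norm_of_real by simp
  qed
  also have "\<dots> \<le> (\<integral>t. M / 2 * ((cmod (u t))\<^sup>2 / T + indicator {0<..B} t / T ^ 3) \<partial>half_line)"
    unfolding L
  proof (intro order.trans[OF integral_norm_bound] integral_mono integrable_norm)
    show "integrable half_line (\<lambda>t. ?I t * ((C * \<psi>'' t + of_real (C * \<mu>\<^sup>2) * \<psi> t) * u t))"
    proof (intro integrable_continuous_mult_L2)
      have "continuous_on UNIV \<psi>"
        using B unfolding \<psi>_def[abs_def] E_def Q_def by (intro continuous_intros) auto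
      then show "continuous_on {0..} (\<lambda>t. C * \<psi>'' t + of_real (C * \<mu>\<^sup>2) * \<psi> t)"
        using cont2 by (intro continuous_intros) (auto intro: continuous_on_subset)
    qed (use u H2_imp_L2 in auto)
    show "integrable half_line (\<lambda>t. M / 2 * ((cmod (u t))\<^sup>2 / T + indicator {0<..B} t / T ^ 3))"
      using L2_square_integrable[OF H2_imp_L2[OF u]] half_line_integrable_indicator[of 0 B]
      by (intro integrable_mult_right Bochner_Integration.integrable_add integrable_divide)
    fix t :: real
    show "cmod (?I t * ((C * \<psi>'' t + of_real (C * \<mu>\<^sup>2) * \<psi> t) * u t))
        \<le> M / 2 * ((cmod (u t))\<^sup>2 / T + indicator {0<..B} t / T ^ 3)"
    proof (cases "t \<in> {0<..B}")
      case True
      define s where "s = t / B"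
      have s: "0 \<le> s" "s \<le> 1" using True B by (auto simp: s_def)
      have s2: "0 \<le> s^2" "s^2 \<le> 1" "0 \<le> s^3" "s^3 \<le> 1" using s by (auto intro: power_le_one)
      have "\<bar>2 * s - 6 * s^2 + 4 * s^3\<bar> \<le> 12" "\<bar>2 - 12 * s + 12 * s^2\<bar> \<le> 26"
        using s s2 by linarith+
      then have q': "\<bar>Q' t\<bar> \<le> 12 / B" and "\<bar>Q'' t\<bar> \<le> 26 / B\<^sup>2"
        using B unfolding Q'_def Q''_def s_def[symmetric] by (simp_all add: divide_right_mono)
      note this(2)
      also have "\<dots> \<le> 26 / B"
        using B by (auto simp: field_simps power2_eq_square)
      finally have q'': "\<bar>Q'' t\<bar> \<le> 26 / B" .
      \<comment> \<open>The terms with \<open>Q\<close> itself cancel because the frequency is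
        resonant; each derivative of \<open>Q\<close> that remains is of order \<open>1 / B\<close>
        or smaller.\<close>
      have "C * \<psi>'' t + of_real (C * \<mu>\<^sup>2) * \<psi> t = C * E t * (of_real (Q'' t) + 2 * \<i> * \<mu> * of_real (Q' t))"
        by (simp add: \<psi>''_def \<psi>_def algebra_simps)
      also have "cmod \<dots> \<le> C * (\<bar>Q'' t\<bar> + 2 * \<mu> * \<bar>Q' t\<bar>)"
      proof -
        have "cmod (of_real (Q'' t) + 2 * \<i> * \<mu> * of_real (Q' t)) \<le> \<bar>Q'' t\<bar> + 2 * \<mu> * \<bar>Q' t\<bar>"
          using \<mu> by (intro order.trans[OF norm_triangle_ineq]) (simp add: norm_mult)
        then show ?thesis using C by (simp add: norm_mult E_def)
      qed
      also have "\<dots> \<le> C * (26 / B + 2 * \<mu> * (12 / B))"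
        using C \<mu> q' q'' by (intro mult_left_mono add_mono) auto
      also have "\<dots> = M / B" by (simp add: M_def field_simps add_divide_distrib)
      finally have b: "cmod (C * \<psi>'' t + of_real (C * \<mu>\<^sup>2) * \<psi> t) \<le> M / B" .
      have "cmod (?I t * ((C * \<psi>'' t + of_real (C * \<mu>\<^sup>2) * \<psi> t) * u t)) \<le> M / B * cmod (u t)"
        using True mult_right_mono[OF b norm_ge_zero[of "u t"]] by (simp add: norm_mult)
      \<comment> \<open>Prepares a weighted arithmetic-geometric inequality. With
        \<open>B = T^2\<close> the square of \<open>u\<close> gets weight \<open>1 / T\<close>, and
        the constant \<open>1 / T^3\<close> integrated over length \<open>T^2\<close> again gives
        \<open>1 / T\<close>.\<close>
      also have "\<dots> = M / 2 * (2 * (T * cmod (u t)) * 1 / T ^ 3)"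
        using T by (simp add: B_def power2_eq_square power3_eq_cube)
      also have "\<dots> \<le> M / 2 * (((T * cmod (u t))\<^sup>2 + 1\<^sup>2) / T ^ 3)"
        using M T by (intro mult_left_mono divide_right_mono sum_squares_bound) auto
      also have "\<dots> = M / 2 * ((cmod (u t))\<^sup>2 / T + indicator {0<..B} t / T ^ 3)"
        using T True by (simp add: power2_eq_square power3_eq_cube field_simps)
      finally show ?thesis .
    next
      case False
      then show ?thesis using M T by simp
    qed
  qed
  also have "\<dots> = M / 2 * (U / T + B / T ^ 3)"
  proof -
    have "complex_of_real (\<integral>t. indicator {0<..B} t \<partial>half_line) = (\<integral>t. ?I t * 1 \<partial>half_line)"
      by (simp only: integral_complex_of_real[symmetric] of_real_indicator mult_1_right)
    also have "\<dots> = complex_of_real B - complex_of_real 0"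
      using B by (intro half_line_FTC has_vector_derivative_of_real[where D=1, simplified])
                 (auto intro!: derivative_eq_intros)
    finally have "(\<integral>t. indicator {0<..B} t \<partial>half_line) = B"
      by (simp only: of_real_0 diff_0_right of_real_eq_iff)
    then show ?thesis
      using L2_square_integrable[OF H2_imp_L2[OF u]] half_line_integrable_indicator[of 0 B]
      by (simp add: U_def)
  qed
  also have "\<dots> = M / 2 * (U + 1) / T"
    using T by (simp add: B_def power2_eq_square power3_eq_cube field_simps)
  also have "\<dots> < 1 / 30"
    using T by (simp add: field_simps)
  finally show False by simp
qed

lemma resolvent_set_nonreal:
  assumes "n \<ge> 1" "c 1 > 0" "z \<in> resolvent_set n c a" "Re z \<ge> a 1"
  shows "Im z \<noteq> 0"
proof
  assume im: "Im z = 0"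
  \<comment> \<open>The bound \<open>Re z \<ge> a 1\<close> makes this a real frequency: on the
    first branch the equation reads \<open>c 1 * (u'' + \<mu>^2 * u) = f\<close>. The value 0 is
    included.\<close>
  define \<mu> where "\<mu> = sqrt ((Re z - a 1) / c 1)"
  have \<mu>: "\<mu> \<ge> 0" "c 1 * \<mu>\<^sup>2 = Re z - a 1"
    using assms by (auto simp: \<mu>_def)
  define f where "f k t = (if k = 1 then exp (- \<i> * complex_of_real (\<mu> * t)) / complex_of_real (max 1 t) else 0)"
    for k :: nat and t
  have "f k \<in> L2" for k
    using L2_slow_decay[of \<mu>] by (cases "k = 1") (auto simp: f_def[abs_def] L2_def)
  then have "f \<in> H_space n" by (simp add: H_space_def)
  then obtain u where u: "u \<in> dom_A n c" "H_eq n (shifted_A c a z u) f"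
    using assms(3) by (auto simp: resolvent_set_def)
  have 1: "1 \<in> {1..n}" using assms(1) by simp
  obtain p where p: "continuous_on {0..} p" "\<forall>x\<ge>0. (u 1 has_vector_derivative p x) (at x within {0..})"
    using dom_A_branch(2)[OF u(1) 1] by blast
  have "z - of_real (a 1) = of_real (c 1 * \<mu>\<^sup>2)"
    using im \<mu>(2) by (simp add: complex_eq_iff)
  with shifted_A_branch[OF u(2) 1]
  have "AE x in half_line. exp (- \<i> * of_real (\<mu> * x)) / of_real (max 1 x)
       = of_real (c 1) * weak_deriv (weak_deriv (u 1)) x + of_real (c 1 * \<mu>\<^sup>2) * u 1 x"
    by (simp add: f_def)
  from resonance[OF dom_A_branch(1)[OF u(1) 1] p \<mu>(1) assms(2) this] show False .
qed

section \<open>The kernel\<close>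

lemma F_deriv:
  fixes n c a z j
  defines "\<xi> \<equiv> xi c a z j" and "s \<equiv> s_coeff n c a z j"
  defines "F' \<equiv> \<lambda>t. - \<xi> * sin (\<xi> * complex_of_real t) + pm z * \<i> * s * \<xi> * cos (\<xi> * complex_of_real t)"
  shows "(F n c a z j j has_vector_derivative F' t) (at t)"
    and "(F' has_vector_derivative - \<xi>\<^sup>2 * F n c a z j j t) (at t)"
    and "continuous_on UNIV (\<lambda>t. - \<xi>\<^sup>2 * F n c a z j j t)"
proof -
  have F: "F n c a z j j = (\<lambda>t. cos (\<xi> * complex_of_real t) + pm z * \<i> * s * sin (\<xi> * complex_of_real t))"
    by (simp add: F_def[abs_def] \<xi>_def s_def)
  show "(F n c a z j j has_vector_derivative F' t) (at t)"
    unfolding F F'_def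
    by (rule has_vector_derivative_real_field) (auto intro!: derivative_eq_intros simp: algebra_simps)
  show "(F' has_vector_derivative - \<xi>\<^sup>2 * F n c a z j j t) (at t)"
    unfolding F F'_def
    by (rule has_vector_derivative_real_field)
       (auto intro!: derivative_eq_intros simp: algebra_simps power2_eq_square)
  show "continuous_on UNIV (\<lambda>t. - \<xi>\<^sup>2 * F n c a z j j t)"
    unfolding F by (intro continuous_intros)
qed

text \<open>The bracket times the exponential is the Wronskian of the two solutions on branch \<open>j\<close>.\<close>

lemma F_wronskian:
  fixes n c a z j t
  defines "\<xi> \<equiv> xi c a z j" and "s \<equiv> s_coeff n c a z j"
  defines "\<kappa> \<equiv> pm z * \<i> * \<xi>"
  defines "F' \<equiv> - \<xi> * sin (\<xi> * complex_of_real t) + pm z * \<i> * s * \<xi> * cos (\<xi> * complex_of_real t)"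
  assumes j: "j \<in> {1..n}" and nz: "c j \<noteq> 0" "\<xi> \<noteq> 0"
  shows "of_real (c j) * exp (\<kappa> * of_real t) * (\<kappa> * F n c a z j j t - F') = w n c a z"
    and "of_real (c j) * \<kappa> * s = - (\<Sum>k\<in>{1..n} - {j}. of_real (c k) * (pm z * \<i> * xi c a z k))"
proof -
  \<comment> \<open>\<open>s_coeff\<close> is the constant for which the function with upper index
    \<open>j\<close> satisfies the flux condition at the vertex: its slopes there are
    \<open>\<kappa> * s\<close> on branch \<open>j\<close> and
    \<open>pm z * \<i> * xi c a z k\<close> on the other branches.\<close>
  have cs: "of_real (c j) * \<xi> * s = - (\<Sum>l\<in>{1..n} - {j}. complex_of_real (c l) * xi c a z l)"
    using nz by (simp add: s_def s_coeff_def \<xi>_def)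
  then have "pm z * \<i> * (of_real (c j) * \<xi> * s)
      = pm z * \<i> * - (\<Sum>l\<in>{1..n} - {j}. complex_of_real (c l) * xi c a z l)" by simp
  then show 2: "of_real (c j) * \<kappa> * s = - (\<Sum>k\<in>{1..n} - {j}. of_real (c k) * (pm z * \<i> * xi c a z k))"
    by (simp add: \<kappa>_def sum_distrib_left mult_ac)
  have w: "w n c a z = of_real (c j) * \<kappa> * (1 - s)"
  proof -
    have "w n c a z = pm z * \<i> * (of_real (c j) * \<xi> + (\<Sum>l\<in>{1..n} - {j}. complex_of_real (c l) * xi c a z l))"
      using j by (simp add: w_def \<xi>_def sum.remove[of _ j])
    also have "(\<Sum>l\<in>{1..n} - {j}. complex_of_real (c l) * xi c a z l) = - (of_real (c j) * \<xi> * s)"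
      using cs by simp
    finally show ?thesis by (simp add: \<kappa>_def algebra_simps)
  qed
  define \<theta> where "\<theta> = \<xi> * complex_of_real t"
  define P where "P = pm z * \<i>"
  have PP: "P * P = - 1" using pm_square[of z] by (simp add: P_def algebra_simps)
  have PPx: "P * (P * x) = - x" for x by (simp add: PP flip: mult.assoc)
  have cs1: "cos \<theta> * cos \<theta> = 1 - sin \<theta> * sin \<theta>"
    using sin_cos_squared_add[of \<theta>] by (simp add: power2_eq_square algebra_simps)
  have e: "exp (\<kappa> * of_real t) = cos \<theta> + P * sin \<theta>"
    using exp_pm[of z \<theta>] by (simp add: \<kappa>_def \<theta>_def P_def mult_ac)
  have "F n c a z j j t = cos \<theta> + P * s * sin \<theta>" "F' = - \<xi> * sin \<theta> + P * s * \<xi> * cos \<theta>" "\<kappa> = P * \<xi>"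
    by (simp_all add: F_def F'_def \<xi>_def s_def \<theta>_def P_def \<kappa>_def)
  \<comment> \<open>The last factor is the growing exponential \<open>exp (- \<kappa> * t)\<close>,
    which is why multiplication by \<open>exp (\<kappa> * t)\<close> leaves a constant.\<close>
  then have "\<kappa> * F n c a z j j t - F' = (1 - s) * \<kappa> * (cos \<theta> - P * sin \<theta>)"
    by (simp add: PPx algebra_simps)
  moreover have "(cos \<theta> + P * sin \<theta>) * (cos \<theta> - P * sin \<theta>) = 1"
    by (simp add: algebra_simps PPx cs1)
  ultimately show "of_real (c j) * exp (\<kappa> * of_real t) * (\<kappa> * F n c a z j j t - F') = w n c a z"
    unfolding e w by (simp add: mult_ac)
qed

section \<open>The resolvent formula\<close>

text \<open>The first three conjuncts give the formula its proper meaning: division by zero and the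
  integral of a non-integrable function would both silently take the default value 0.\<close>

theorem theorem3p8:
  fixes n :: nat and c a :: "nat \<Rightarrow> real" and z :: complex
    and f :: "nat \<Rightarrow> real \<Rightarrow> complex" and j :: nat and x :: real
  assumes "n \<ge> 2"
    and "\<And>k. k \<in> {1..n} \<Longrightarrow> c k > 0"
    and "0 \<le> a 1" and "mono_on {1..n} a"
    and "f \<in> H_space n"
    and "z \<in> resolvent_set n c a" and "Re z \<ge> a 1"
    and "j \<in> {1..n}" and "x \<ge> 0"
  shows "w n c a z \<noteq> 0 \<and> (\<forall>k\<in>{1..n}. xi c a z k \<noteq> 0) \<and>
    (\<forall>k\<in>{1..n}. integrable half_line (\<lambda>x'. K n c a z j x k x' * f k x')) \<and>
    resolvent n c a z f j x = (\<Sum>k=1..n. \<integral>x'. K n c a z j x k x' * f k x' \<partial>half_line)"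
proof -
  have nr: "Im z \<noteq> 0"
    using assms(1,2,6,7) by (intro resolvent_set_nonreal[of n c z a]) auto
  define \<xi> where "\<xi> k = xi c a z k" for k
  define \<kappa> where "\<kappa> k = pm z * \<i> * \<xi> k" for k
  note xi = xi_nonreal[where a=a and c=c, OF nr assms(2), folded \<xi>_def, folded \<kappa>_def]
  define W where "W = w n c a z"
  have "W = (\<Sum>k=1..n. of_real (c k) * \<kappa> k)"
    by (simp add: W_def w_def \<kappa>_def \<xi>_def sum_distrib_left mult_ac)
  then have "Re W = (\<Sum>k=1..n. c k * Re (\<kappa> k))" by simp
  also have "\<dots> < 0"
  proof -
    have "0 < (\<Sum>k=1..n. - (c k * Re (\<kappa> k)))"
      using assms(1,2) xi(1) by (intro sum_pos) (auto intro: mult_pos_neg)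
    then show ?thesis by (simp add: sum_negf)
  qed
  finally have W: "W \<noteq> 0" by auto
  define u where "u = resolvent n c a z f"
  have "\<exists>u. u \<in> dom_A n c \<and> H_eq n (shifted_A c a z u) f"
    using assms(5,6) by (auto simp: resolvent_set_def)
  then have u: "u \<in> dom_A n c" "H_eq n (shifted_A c a z u) f"
    unfolding u_def resolvent_def by (metis (mono_tags, lifting) someI_ex)+
  have "\<forall>k\<in>{1..n}. \<exists>p. continuous_on {0..} p \<and> (\<forall>x\<ge>0. (u k has_vector_derivative p x) (at x within {0..}))"
    using dom_A_branch(2)[OF u(1)] by blast
  then obtain p where p: "\<And>k. k \<in> {1..n} \<Longrightarrow> continuous_on {0..} (p k)"
    "\<And>k. k \<in> {1..n} \<Longrightarrow> \<forall>x\<ge>0. (u k has_vector_derivative p k x) (at x within {0..})"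
    by (metis bchoice)
  have fm: "f k \<in> borel_measurable half_line" if "k \<in> {1..n}" for k
    using assms(5) that by (simp add: H_space_def L2_measurable)
  define U where "U = u j 0"
  have U: "u k 0 = U" if "k \<in> {1..n}" for k
    using u(1) that assms(8) unfolding U_def dom_A_def T0_def by blast
  have kirchhoff: "(\<Sum>k=1..n. of_real (c k) * p k 0) = 0"
  proof -
    have "vector_derivative (u k) (at 0 within {0..}) = p k 0" if "k \<in> {1..n}" for k
      using p(2)[OF that] by (intro vector_derivative_within) (auto simp: trivial_limit_within intro: islimpt_subset[of 0 "{0..1}"])
    then show ?thesis
      using u(1) by (simp add: dom_A_def T1_def scaleR_conv_of_real)
  qed
  have nb: "next_branch n j \<noteq> j" using assms(1) by (rule next_branch_neq)
  have other: "integrable half_line (\<lambda>x'. K n c a z j x k x' * f k x')"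
    "(\<integral>x'. K n c a z j x k x' * f k x' \<partial>half_line)
      = - (1 / W * exp (\<kappa> j * of_real x) * (of_real (c k) * p k 0 - of_real (c k) * \<kappa> k * U))"
    if k: "k \<in> {1..n}" "k \<noteq> j" for k
  proof -
    note b = branch_half_line[OF dom_A_branch(1)[OF u(1) k(1)] p(1)[OF k(1)] p(2)[OF k(1)]
        shifted_A_branch[OF u(2) k(1)] fm[OF k(1)] xi(1)[OF k(1)] xi(2)[OF k(1)] order_refl[of 0]]
    \<comment> \<open>Since \<open>next_branch n j \<noteq> j\<close> and
      \<open>k \<noteq> j\<close>, both factors of the kernel are decaying exponentials here. The
      indicator of \<open>{0<..}\<close> is 1 on the whole branch and only matches the form of
      \<open>branch_half_line\<close> at 0.\<close>
    have e: "K n c a z j x k t * f k t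
        = 1 / W * exp (\<kappa> j * of_real x) * (indicator {0<..} t * (exp (\<kappa> k * of_real t) * f k t))"
      if "t \<in> space half_line" for t
      using that k nb by (simp add: K_def F_def W_def \<kappa>_def \<xi>_def)
    show "integrable half_line (\<lambda>x'. K n c a z j x k x' * f k x')"
      by (rule Bochner_Integration.integrable_cong[OF refl, THEN iffD2, OF _ integrable_mult_right[OF b(1)]])
         (erule e)
    have "(\<integral>x'. K n c a z j x k x' * f k x' \<partial>half_line)
      = (\<integral>t. 1 / W * exp (\<kappa> j * of_real x) * (indicator {0<..} t * (exp (\<kappa> k * of_real t) * f k t)) \<partial>half_line)"
      by (rule Bochner_Integration.integral_cong[OF refl]) (erule e)
    then show "(\<integral>x'. K n c a z j x k x' * f k x' \<partial>half_line)
      = - (1 / W * exp (\<kappa> j * of_real x) * (of_real (c k) * p k 0 - of_real (c k) * \<kappa> k * U))"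
      unfolding integral_mult_right_zero b(2) by (simp add: U[OF k(1)] algebra_simps)
  qed
  define s where "s = s_coeff n c a z j"
  define F0 where "F0 = F n c a z j j"
  define F1 where "F1 = (\<lambda>t. - \<xi> j * sin (\<xi> j * complex_of_real t) + pm z * \<i> * s * \<xi> j * cos (\<xi> j * complex_of_real t))"
  have dF: "(F0 has_vector_derivative F1 t) (at t)" "(F1 has_vector_derivative - (\<xi> j)\<^sup>2 * F0 t) (at t)"
    "continuous_on UNIV (\<lambda>t. - (\<xi> j)\<^sup>2 * F0 t)" for t
    unfolding F0_def F1_def s_def \<xi>_def by (rule F_deriv)+
  note j = assms(8)
  note b1 = branch_half_line[OF dom_A_branch(1)[OF u(1) j] p(1)[OF j] p(2)[OF j]
      shifted_A_branch[OF u(2) j] fm[OF j] xi(1)[OF j] xi(2)[OF j] assms(9)]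
  note b2 = branch_interval[OF dom_A_branch(1)[OF u(1) j] p(1)[OF j] p(2)[OF j]
      shifted_A_branch[OF u(2) j] fm[OF j] dF order_refl[of 0] assms(9)]
  have eq0: "of_real (c j) * (- (\<xi> j)\<^sup>2 * F0 t) + (z - of_real (a j)) * F0 t = 0" for t
    unfolding xi(3)[OF j, symmetric] by (simp add: algebra_simps)
  have F00: "F0 0 = 1" "F1 0 = \<kappa> j * s"
    by (simp_all add: F0_def F1_def F_def \<kappa>_def)
  \<comment> \<open>At \<open>t = x\<close> the kernel takes its second case, in agreement with
    \<open>{0<..x}\<close> containing \<open>x\<close>.\<close>
  have e: "K n c a z j x j t * f j t
      = 1 / W * F0 x * (indicator {x<..} t * (exp (\<kappa> j * of_real t) * f j t))
        + 1 / W * exp (\<kappa> j * of_real x) * (indicator {0<..x} t * (F0 t * f j t))"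
    if "t \<in> space half_line" for t
    using that nb by (auto simp: K_def F_def[of n c a z "next_branch n j"] W_def \<kappa>_def \<xi>_def F0_def)
  have same_int: "integrable half_line (\<lambda>x'. K n c a z j x j x' * f j x')"
    by (rule Bochner_Integration.integrable_cong[OF refl, THEN iffD2, OF _
          Bochner_Integration.integrable_add[OF integrable_mult_right[OF b1(1)] integrable_mult_right[OF b2(1)]]])
       (erule e)
  have wr: "of_real (c j) * exp (\<kappa> j * of_real x) * (\<kappa> j * F0 x - F1 x) = W"
    "of_real (c j) * \<kappa> j * s = - (\<Sum>k\<in>{1..n} - {j}. of_real (c k) * \<kappa> k)"
    using F_wronskian(1)[where n=n and c=c and a=a and z=z and j=j and t=x]
      F_wronskian(2)[where n=n and c=c and a=a and z=z and j=j] j assms(2)[OF j] xi(4)[OF j]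
    by (simp_all add: F0_def F1_def W_def \<kappa>_def \<xi>_def s_def)
  have same: "(\<integral>x'. K n c a z j x j x' * f j x' \<partial>half_line)
      = u j x - 1 / W * exp (\<kappa> j * of_real x) * (of_real (c j) * p j 0 - of_real (c j) * \<kappa> j * s * U)"
  proof -
    have "(\<integral>x'. K n c a z j x j x' * f j x' \<partial>half_line)
      = 1 / W * F0 x * (- of_real (c j) * exp (\<kappa> j * of_real x) * (p j x - \<kappa> j * u j x))
        + 1 / W * exp (\<kappa> j * of_real x)
            * (of_real (c j) * ((F0 x * p j x - F1 x * u j x) - (F0 0 * p j 0 - F1 0 * u j 0)))"
    proof -
      have "(\<integral>x'. K n c a z j x j x' * f j x' \<partial>half_line)
        = (\<integral>t. 1 / W * F0 x * (indicator {x<..} t * (exp (\<kappa> j * of_real t) * f j t))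
          + 1 / W * exp (\<kappa> j * of_real x) * (indicator {0<..x} t * (F0 t * f j t)) \<partial>half_line)"
        by (rule Bochner_Integration.integral_cong[OF refl]) (erule e)
      also have "\<dots> = 1 / W * F0 x * (\<integral>t. indicator {x<..} t * (exp (\<kappa> j * of_real t) * f j t) \<partial>half_line)
          + 1 / W * exp (\<kappa> j * of_real x) * (\<integral>t. indicator {0<..x} t * (F0 t * f j t) \<partial>half_line)"
        by (simp only: Bochner_Integration.integral_add integrable_mult_right b1(1) b2(1) integral_mult_right_zero)
      finally show ?thesis
        unfolding b1(2) b2(2) eq0 by simp
    qed
    \<comment> \<open>The two terms with \<open>p j x\<close> cancel; the coefficient of
      \<open>u j x\<close> is the Wronskian expression of \<open>wr(1)\<close>, equal to
      \<open>W\<close>.\<close>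
    also have "\<dots> = 1 / W * (of_real (c j) * exp (\<kappa> j * of_real x) * (\<kappa> j * F0 x - F1 x)) * u j x
       - 1 / W * exp (\<kappa> j * of_real x) * (of_real (c j) * p j 0 - of_real (c j) * \<kappa> j * s * U)"
      by (simp add: F00 U[OF j] algebra_simps)
    finally show ?thesis using W by (simp add: wr(1))
  qed
  have "(\<Sum>k=1..n. \<integral>x'. K n c a z j x k x' * f k x' \<partial>half_line)
      = (\<integral>x'. K n c a z j x j x' * f j x' \<partial>half_line)
        + (\<Sum>k\<in>{1..n} - {j}. \<integral>x'. K n c a z j x k x' * f k x' \<partial>half_line)"
    using j by (simp add: sum.remove[of _ j])
  also have "(\<Sum>k\<in>{1..n} - {j}. \<integral>x'. K n c a z j x k x' * f k x' \<partial>half_line)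
      = (\<Sum>k\<in>{1..n} - {j}. - (1 / W * exp (\<kappa> j * of_real x) * (of_real (c k) * p k 0 - of_real (c k) * \<kappa> k * U)))"
    using other(2) by (intro sum.cong) auto
  also have "\<dots> = - (1 / W * exp (\<kappa> j * of_real x)
      * ((\<Sum>k\<in>{1..n} - {j}. of_real (c k) * p k 0) - (\<Sum>k\<in>{1..n} - {j}. of_real (c k) * \<kappa> k) * U))"
    by (simp only: sum_negf sum_distrib_left[symmetric] sum_distrib_right sum_subtractf)
  \<comment> \<open>Two flux balances at the vertex absorb what \<open>same\<close> leaves over:
    that of \<open>u\<close> for the derivatives \<open>p k 0\<close>, and that of the kernel
    function with upper index \<open>j\<close> for the multiples of the common value
    \<open>U\<close>.\<close>
  also have "(\<Sum>k\<in>{1..n} - {j}. of_real (c k) * p k 0) = - (of_real (c j) * p j 0)"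
    using kirchhoff j by (simp add: sum.remove[of _ j] add_eq_0_iff2)
  also have "(\<Sum>k\<in>{1..n} - {j}. of_real (c k) * \<kappa> k) = - (of_real (c j) * \<kappa> j * s)"
    using wr(2) by simp
  finally have "(\<Sum>k=1..n. \<integral>x'. K n c a z j x k x' * f k x' \<partial>half_line) = u j x"
    unfolding same by (simp add: algebra_simps)
  moreover have "integrable half_line (\<lambda>x'. K n c a z j x k x' * f k x')" if "k \<in> {1..n}" for k
    using same_int other(1) that by (cases "k = j") auto
  moreover have "xi c a z k \<noteq> 0" if "k \<in> {1..n}" for k
    using xi(4)[OF that] by (simp add: \<xi>_def)
  ultimately show ?thesis using W by (simp add: W_def u_def)
qed

end
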